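(* Let $d\ge 1$, $n\ge 3$, let $u\in\mathbb{C}\setminus\{0\}$, and let $z,x_1,\ldots,x_{d-1}\in\mathbb{C}$ be the parameters of the Markov trace $\mathrm{tr}$ on $\bigcup_{n}\mathrm{Y}_{d,n}(u)$. Put $x_0=1$ and let $x:\mathbb{Z}/d\mathbb{Z}\to\mathbb{C}$, $k\mapsto x_k$, with Fourier transform $\widehat{x}(m)=\sum_{k=0}^{d-1}x_k\,e^{-2\pi i km/d}$. Then $\mathrm{tr}$ passes to the quotient algebra $\mathrm{FTL}_{d,n}(u)$ if and only if there are disjoint subsets $\mathrm{Sup}_1,\mathrm{Sup}_2\subseteq\mathbb{Z}/d\mathbb{Z}$ with $\mathrm{Sup}_1\cup\mathrm{Sup}_2$ equal to the support $\{m:\widehat{x}(m)\neq 0\}$ of $\widehat{x}$, such that $$x_k=-z\Big(\sum_{m\in\mathrm{Sup}_1}e^{2\pi i km/d}+(u+1)\sum_{m\in\mathrm{Sup}_2}e^{2\pi i km/d}\Big)\quad(k\in\mathbb{Z}/d\mathbb{Z})\qquad\text{and}\qquad z=-\frac{1}{|\mathrm{Sup}_1|+(u+1)|\mathrm{Sup}_2|}.$$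
   Context: The Yokonuma–Hecke algebra $\mathrm{Y}_{d,n}(u)$ is the unital associative $\mathbb{C}$-algebra with generators $g_1,\ldots,g_{n-1},t_1,\ldots,t_n$ and relations: $g_ig_j=g_jg_i$ for $|i-j|>1$; $g_{i+1}g_ig_{i+1}=g_ig_{i+1}g_i$; $t_it_j=t_jt_i$; $t_i^d=1$; $g_it_i=t_{i+1}g_i$; $g_it_{i+1}=t_ig_i$; $g_it_j=t_jg_i$ for $j\ne i,i+1$; $g_i^2=1+(u-1)e_i+(u-1)e_ig_i$, where $e_i=\frac1d\sum_{s=0}^{d-1}t_i^st_{i+1}^{d-s}$. There are natural inclusions $\mathrm{Y}_{d,n}(u)\subset\mathrm{Y}_{d,n+1}(u)$. For $w\in S_n$ with reduced expression $s_{i_1}\cdots s_{i_k}$ ($s_i=(i,i+1)$) put $g_w=g_{i_1}\cdots g_{i_k}$ (well defined). Let $g_{i,i+1}=\sum_{w\in\langle s_i,s_{i+1}\rangle}g_w$ (sum over the six elements of the subgroup of $S_n$ generated by $s_i,s_{i+1}$), and $r_{i,i+1}=\sum_{a,b=0}^{d-1}t_i^{a}t_{i+1}^{b-a}t_{i+2}^{-b}\,g_{i,i+1}$ for $1\le i\le n-2$ (this is the sum of $g_x$ over the subgroup $\langle t_it_{i+1}^{-1},t_{i+1}t_{i+2}^{-1}\rangle\rtimes\langle s_i,s_{i+1}\rangle$ of $(\mathbb{Z}/d\mathbb{Z})^n\rtimes S_n$, where $g_{t_1^{a_1}\cdots t_n^{a_n}w}=t_1^{a_1}\cdots t_n^{a_n}g_w$).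 $\mathrm{FTL}_{d,n}(u)$ is the quotient of $\mathrm{Y}_{d,n}(u)$ by the two-sided ideal generated by $r_{1,2},\ldots,r_{n-2,n-1}$. For complex numbers $z,x_1,\ldots,x_{d-1}$ there is a unique linear map $\mathrm{tr}$ on $\bigcup_n\mathrm{Y}_{d,n}(u)$ with $\mathrm{tr}(ab)=\mathrm{tr}(ba)$, $\mathrm{tr}(1)=1$, $\mathrm{tr}(ag_n)=z\,\mathrm{tr}(a)$, $\mathrm{tr}(at_{n+1}^s)=x_s\,\mathrm{tr}(a)$ for $a,b\in\mathrm{Y}_{d,n}(u)$, $1\le s\le d-1$. "$\mathrm{tr}$ passes to $\mathrm{FTL}_{d,n}(u)$" means $\mathrm{tr}$ vanishes on the defining two-sided ideal of $\mathrm{FTL}_{d,n}(u)$ in $\mathrm{Y}_{d,n}(u)$. *)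

theory Defs
  imports Complex_Main
begin

text \<open>Generators of the Yokonuma-Hecke algebras: YG i is g_i, YT i is t_i (indices start at 1).
  Elements of the free algebra on these generators are represented as formal linear
  combinations of words (lists of generators).\<close>

datatype ygen = YG nat | YT nat

type_synonym yword = "ygen list"
type_synonym ylc = "(complex \<times> yword) list"

definition lc_eval :: "(yword \<Rightarrow> complex) \<Rightarrow> ylc \<Rightarrow> complex" where
  "lc_eval \<phi> p = sum_list (map (\<lambda>(c, w). c * \<phi> w) p)"

definition lc_mult :: "ylc \<Rightarrow> ylc \<Rightarrow> ylc" where
  "lc_mult p q = [(a * b, v @ w). (a, v) \<leftarrow> p, (b, w) \<leftarrow> q]"

definition lc_smult :: "complex \<Rightarrow> ylc \<Rightarrow> ylc" where
  "lc_smult c p = map (\<lambda>(a, w). (c * a, w)) p"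

definition lc_word :: "yword \<Rightarrow> ylc" where
  "lc_word w = [(1, w)]"

definition in_Y :: "nat \<Rightarrow> yword \<Rightarrow> bool" where
  "in_Y n w = (\<forall>a\<in>set w. case a of YG i \<Rightarrow> 1 \<le> i \<and> i < n | YT i \<Rightarrow> 1 \<le> i \<and> i \<le> n)"

definition tpow :: "nat \<Rightarrow> nat \<Rightarrow> yword" where
  "tpow i k = replicate k (YT i)"

definition e_lc :: "nat \<Rightarrow> nat \<Rightarrow> ylc" where
  "e_lc d i = [(1 / of_nat d, tpow i s @ tpow (Suc i) (d - s)). s \<leftarrow> [0..<d]]"

text \<open>Defining relations of Y_{d,n}(u) (for all n), each written as lhs - rhs.\<close>
definition Y_rels :: "nat \<Rightarrow> complex \<Rightarrow> ylc set" where
  "Y_rels d u =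
     {[(1, [YG i, YG j]), (-1, [YG j, YG i])] | i j. 1 \<le> i \<and> 1 \<le> j \<and> (i + 1 < j \<or> j + 1 < i)}
   \<union> {[(1, [YG (Suc i), YG i, YG (Suc i)]), (-1, [YG i, YG (Suc i), YG i])] | i. 1 \<le> i}
   \<union> {[(1, [YT i, YT j]), (-1, [YT j, YT i])] | i j. 1 \<le> i \<and> 1 \<le> j}
   \<union> {[(1, tpow i d), (-1, [])] | i. 1 \<le> i}
   \<union> {[(1, [YG i, YT i]), (-1, [YT (Suc i), YG i])] | i. 1 \<le> i}
   \<union> {[(1, [YG i, YT (Suc i)]), (-1, [YT i, YG i])] | i. 1 \<le> i}
   \<union> {[(1, [YG i, YT j]), (-1, [YT j, YG i])] | i j. 1 \<le> i \<and> 1 \<le> j \<and> j \<noteq> i \<and> j \<noteq> Suc i}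
   \<union> {[(1, [YG i, YG i]), (-1, [])] @ lc_smult (-(u - 1)) (e_lc d i)
        @ lc_smult (-(u - 1)) (lc_mult (e_lc d i) (lc_word [YG i])) | i. 1 \<le> i}"

text \<open>A functional on words descends to the algebra bigcup_n Y_{d,n}(u), i.e. vanishes on the
  two-sided ideal generated by the defining relations.\<close>
definition vanishes_on_Y_ideal :: "nat \<Rightarrow> complex \<Rightarrow> (yword \<Rightarrow> complex) \<Rightarrow> bool" where
  "vanishes_on_Y_ideal d u \<phi> =
     (\<forall>r\<in>Y_rels d u. \<forall>n v w. in_Y n v \<longrightarrow> in_Y n w \<longrightarrow>
        lc_eval \<phi> (lc_mult (lc_mult (lc_word v) r) (lc_word w)) = 0)"

text \<open>The Markov trace tr on bigcup_n Y_{d,n}(u) with parameters z, x_1, ..., x_{d-1}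
  (by linearity it suffices to state the conditions on words).\<close>
definition is_markov_trace ::
  "nat \<Rightarrow> complex \<Rightarrow> complex \<Rightarrow> (nat \<Rightarrow> complex) \<Rightarrow> (yword \<Rightarrow> complex) \<Rightarrow> bool" where
  "is_markov_trace d u z x tr =
     (vanishes_on_Y_ideal d u tr
      \<and> tr [] = 1
      \<and> (\<forall>n v w. in_Y n v \<longrightarrow> in_Y n w \<longrightarrow> tr (v @ w) = tr (w @ v))
      \<and> (\<forall>n a. 1 \<le> n \<longrightarrow> in_Y n a \<longrightarrow> tr (a @ [YG n]) = z * tr a)
      \<and> (\<forall>n a s. in_Y n a \<longrightarrow> 1 \<le> s \<longrightarrow> s \<le> d - 1 \<longrightarrow> tr (a @ tpow (Suc n) s) = x s * tr a))"

text \<open>g_{i,i+1}: sum of g_w over the subgroup generated by s_i, s_{i+1}\<close>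
definition g_sym3 :: "nat \<Rightarrow> yword list" where
  "g_sym3 i = [[], [YG i], [YG (Suc i)], [YG i, YG (Suc i)], [YG (Suc i), YG i],
               [YG i, YG (Suc i), YG i]]"

text \<open>r_{i,i+1} = sum_{a,b=0}^{d-1} t_i^a t_{i+1}^{b-a} t_{i+2}^{-b} g_{i,i+1}
  (exponents of t taken mod d, as t^d = 1)\<close>
definition r_lc :: "nat \<Rightarrow> nat \<Rightarrow> ylc" where
  "r_lc d i = [(1, tpow i a @ tpow (Suc i) (nat ((int b - int a) mod int d))
                    @ tpow (Suc (Suc i)) (nat ((- int b) mod int d)) @ g).
               a \<leftarrow> [0..<d], b \<leftarrow> [0..<d], g \<leftarrow> g_sym3 i]"

text \<open>tr passes to FTL_{d,n}(u): tr vanishes on the two-sided ideal of Y_{d,n}(u)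
  generated by r_{1,2}, ..., r_{n-2,n-1}.\<close>
definition passes_FTL :: "nat \<Rightarrow> nat \<Rightarrow> (yword \<Rightarrow> complex) \<Rightarrow> bool" where
  "passes_FTL d n tr =
     (\<forall>i v w. 1 \<le> i \<longrightarrow> i \<le> n - 2 \<longrightarrow> in_Y n v \<longrightarrow> in_Y n w \<longrightarrow>
        lc_eval tr (lc_mult (lc_mult (lc_word v) (r_lc d i)) (lc_word w)) = 0)"

definition xext :: "(nat \<Rightarrow> complex) \<Rightarrow> nat \<Rightarrow> complex" where
  "xext x k = (if k = 0 then 1 else x k)"

definition fourier_hat :: "nat \<Rightarrow> (nat \<Rightarrow> complex) \<Rightarrow> nat \<Rightarrow> complex" where
  "fourier_hat d x m = (\<Sum>k<d. xext x k * exp (- 2 * pi * \<i> * of_nat (k * m) / of_nat d))"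

definition fourier_support :: "nat \<Rightarrow> (nat \<Rightarrow> complex) \<Rightarrow> nat set" where
  "fourier_support d x = {m. m < d \<and> fourier_hat d x m \<noteq> 0}"

end

theory Submission
  imports Defs "HOL-Library.Multiset"
begin

text \<open>
  Everything is done dually, with functionals on words that vanish on the ideal of defining
  relations. Since \<open>Y\<^bsub>n+1\<^esub>\<close> is spanned by \<open>a g\<^sub>n b\<close> and \<open>a t\<^bsub>n+1\<^esub>\<^sup>k b\<close> with \<open>a\<close>, \<open>b\<close> in \<open>Y\<^sub>n\<close>, the
  Markov property reduces \<open>tr (m r\<^bsub>1,2\<^esub>) = 0\<close> for \<open>m\<close> in \<open>Y\<^sub>n\<close> to the case \<open>m\<close> in \<open>Y\<^sub>3\<close>; there
  \<open>g\<^sub>j r\<^bsub>1,2\<^esub> = u r\<^bsub>1,2\<^esub>\<close> and \<open>t\<^sub>1 r\<^bsub>1,2\<^esub> = t\<^sub>2 r\<^bsub>1,2\<^esub> = t\<^sub>3 r\<^bsub>1,2\<^esub>\<close> leave only the \<open>d\<close> equations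
  \<open>tr (t\<^sub>1\<^sup>k r\<^bsub>1,2\<^esub>) = 0\<close>. The other \<open>r\<^bsub>i,i+1\<^esub>\<close> are conjugate to \<open>r\<^bsub>1,2\<^esub>\<close>, as the \<open>g\<^sub>j\<close> are invertible for
  \<open>u \<noteq> 0\<close>. Computing the traces gives the convolution equation
  \<open>x * x * x + d z (u + 2) (x * x) + d\<^sup>2 z\<^sup>2 (u + 1) x = 0\<close>, whose Fourier transform is
  \<open>y (y + d z) (y + d z (u + 1)) = 0\<close> at every frequency. The supports \<open>Sup\<^sub>1\<close> and \<open>Sup\<^sub>2\<close> are the
  places where \<open>y\<close> is the first or the second nonzero root, and \<open>x\<^sub>0 = 1\<close> gives the value of \<open>z\<close>.
\<close>

subsection \<open>Functionals on the Yokonuma-Hecke algebra\<close>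

text \<open>Unlike in \<open>vanishes_on_Y_ideal\<close>, the contexts \<open>v\<close>, \<open>w\<close> are arbitrary words; a Markov trace is
  made to fit by setting it to \<open>0\<close> on words that contain a generator of index \<open>0\<close>.\<close>
definition Yfun :: "nat \<Rightarrow> complex \<Rightarrow> (yword \<Rightarrow> complex) \<Rightarrow> bool" where
  "Yfun d u \<phi> \<longleftrightarrow> (\<forall>r\<in>Y_rels d u. \<forall>v w. lc_eval (\<lambda>y. \<phi> (v @ y @ w)) r = 0)"

lemma lc_eval_Nil [simp]: "lc_eval \<phi> [] = 0"
  and lc_eval_Cons [simp]: "lc_eval \<phi> ((c, w) # p) = c * \<phi> w + lc_eval \<phi> p"
  and lc_eval_append [simp]: "lc_eval \<phi> (p @ q) = lc_eval \<phi> p + lc_eval \<phi> q"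
  by (simp_all add: lc_eval_def)

lemma lc_eval_smult [simp]: "lc_eval \<phi> (lc_smult c p) = c * lc_eval \<phi> p"
  by (induction p) (auto simp: lc_smult_def algebra_simps)

lemma lc_mult_word_right: "lc_mult p (lc_word w) = map (\<lambda>(a, v). (a, v @ w)) p"
  by (induction p) (auto simp: lc_mult_def lc_word_def)

lemma lc_mult_word_left: "lc_mult (lc_word v) p = map (\<lambda>(b, w). (b, v @ w)) p"
  by (induction p) (auto simp: lc_mult_def lc_word_def)

lemma lc_eval_map_word:
  "lc_eval \<phi> (map (\<lambda>(a, v). (a, f v)) p) = lc_eval (\<lambda>y. \<phi> (f y)) p"
  by (induction p) auto

lemma lc_eval_sandwich:
  "lc_eval \<phi> (lc_mult (lc_mult (lc_word v) r) (lc_word w)) = lc_eval (\<lambda>y. \<phi> (v @ y @ w)) r"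
  unfolding lc_mult_word_right lc_mult_word_left lc_eval_map_word by simp

lemma lc_eval_sum: "lc_eval (\<lambda>y. \<Sum>i\<in>I. f i y) r = (\<Sum>i\<in>I. lc_eval (f i) r)"
  by (induction r) (auto simp: sum_distrib_left sum.distrib)

lemma lc_eval_e_lc:
  "lc_eval \<phi> (e_lc d i) = (\<Sum>s<d. \<phi> (tpow i s @ tpow (Suc i) (d - s))) / of_nat d"
proof -
  have "lc_eval \<phi> (e_lc d i)
      = sum_list (map (\<lambda>s. \<phi> (tpow i s @ tpow (Suc i) (d - s)) / of_nat d) [0..<d])"
    by (simp add: lc_eval_def e_lc_def comp_def)
  also have "\<dots> = (\<Sum>s<d. \<phi> (tpow i s @ tpow (Suc i) (d - s)) / of_nat d)"
    by (simp add: interv_sum_list_conv_sum_set_nat atLeast0LessThan)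
  finally show ?thesis by (simp add: sum_divide_distrib)
qed

text \<open>The ideal is two-sided, so fixing the outer part of a word again gives a functional that
  vanishes on it.\<close>

lemma Yfun_context: assumes "Yfun d u \<phi>" shows "Yfun d u (\<lambda>y. \<phi> (a @ y @ b))"
  unfolding Yfun_def
proof (intro ballI allI)
  fix r v w assume "r \<in> Y_rels d u"
  with assms have "lc_eval (\<lambda>y. \<phi> ((a @ v) @ y @ (w @ b))) r = 0"
    unfolding Yfun_def by blast
  then show "lc_eval (\<lambda>y. \<phi> (a @ (v @ y @ w) @ b)) r = 0" by simp
qed

lemma Yfun_prefix: "Yfun d u \<phi> \<Longrightarrow> Yfun d u (\<lambda>y. \<phi> (a @ y))"
  using Yfun_context[of d u \<phi> a "[]"] by simp

lemma Yfun_suffix: "Yfun d u \<phi> \<Longrightarrow> Yfun d u (\<lambda>y. \<phi> (y @ b))"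
  using Yfun_context[of d u \<phi> "[]" b] by simp

lemma Yfun_sum: "(\<And>i. i \<in> I \<Longrightarrow> Yfun d u (f i)) \<Longrightarrow> Yfun d u (\<lambda>y. \<Sum>i\<in>I. f i y)"
  unfolding Yfun_def by (auto simp: lc_eval_sum intro!: sum.neutral)

lemma Yfun_add: "Yfun d u f \<Longrightarrow> Yfun d u g \<Longrightarrow> Yfun d u (\<lambda>y. f y + g y)"
  using Yfun_sum[of "{True, False}" d u "\<lambda>b. if b then f else g"] by simp

text \<open>The one defining relation that does not equate two words, hence usable only through a
  functional.\<close>

lemma Yfun_quadratic:
  assumes "Yfun d u \<phi>" "1 \<le> i"
  shows "\<phi> (v @ YG i # YG i # w) = \<phi> (v @ w)
     + (u - 1) * ((\<Sum>s<d. \<phi> (v @ tpow i s @ tpow (Suc i) (d - s) @ w)) / of_nat d)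
     + (u - 1) * ((\<Sum>s<d. \<phi> (v @ tpow i s @ tpow (Suc i) (d - s) @ YG i # w)) / of_nat d)"
proof -
  have "[(1, [YG i, YG i]), (-1, [])] @ lc_smult (-(u - 1)) (e_lc d i)
        @ lc_smult (-(u - 1)) (lc_mult (e_lc d i) (lc_word [YG i])) \<in> Y_rels d u"
    using assms(2) unfolding Y_rels_def by blast
  from assms(1)[unfolded Yfun_def, rule_format, OF this, of v w]
  have "\<phi> (v @ YG i # YG i # w) - \<phi> (v @ w)
     - (u - 1) * ((\<Sum>s<d. \<phi> (v @ tpow i s @ tpow (Suc i) (d - s) @ w)) / of_nat d)
     - (u - 1) * ((\<Sum>s<d. \<phi> (v @ tpow i s @ tpow (Suc i) (d - s) @ YG i # w)) / of_nat d) = 0"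
    unfolding lc_eval_append lc_eval_Cons lc_eval_Nil lc_eval_smult lc_eval_e_lc
      lc_mult_word_right lc_eval_map_word minus_mult_left[symmetric] append.assoc
    by (simp add: add_diff_eq)
  then show ?thesis by (simp only: diff_diff_eq right_minus_eq add.assoc)
qed

subsection \<open>Monomial relations\<close>

text \<open>Equality of two words modulo the relations, tested by functionals so that no quotient
  algebra has to be built.\<close>

definition weq :: "nat \<Rightarrow> complex \<Rightarrow> yword \<Rightarrow> yword \<Rightarrow> bool" where
  "weq d u v w \<longleftrightarrow> (\<forall>\<phi>. Yfun d u \<phi> \<longrightarrow> \<phi> v = \<phi> w)"

lemma weqD: "weq d u v w \<Longrightarrow> Yfun d u \<phi> \<Longrightarrow> \<phi> v = \<phi> w"
  by (simp add: weq_def)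

lemma weq_refl [simp]: "weq d u w w"
  by (simp add: weq_def)

lemma weq_sym: "weq d u v w \<Longrightarrow> weq d u w v"
  unfolding weq_def by (intro allI impI) (drule spec, drule (1) mp, simp)+

lemma weq_trans [trans]: "weq d u v w \<Longrightarrow> weq d u w y \<Longrightarrow> weq d u v y"
  unfolding weq_def by (intro allI impI) (drule spec, drule (1) mp, simp)+

lemma weq_context: assumes "weq d u v w" shows "weq d u (a @ v @ b) (a @ w @ b)"
  unfolding weq_def
proof (intro allI impI)
  fix \<phi> assume "Yfun d u \<phi>"
  from weqD[OF assms Yfun_context[OF this]] show "\<phi> (a @ v @ b) = \<phi> (a @ w @ b)" .
qed

lemma weq_append: "weq d u v w \<Longrightarrow> weq d u v' w' \<Longrightarrow> weq d u (v @ v') (w @ w')"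
  using weq_context[of d u v w "[]" v'] weq_context[of d u v' w' w "[]"]
  by (auto intro: weq_trans)

lemma weq_Cons: "weq d u v w \<Longrightarrow> weq d u (a # v) (a # w)"
  using weq_context[of d u v w "[a]" "[]"] by simp

lemma weq_binomial_relation: assumes "[(1, v), (-1, w)] \<in> Y_rels d u" shows "weq d u v w"
  unfolding weq_def
proof (intro allI impI)
  fix \<phi> assume "Yfun d u \<phi>"
  from this[unfolded Yfun_def, rule_format, OF assms, of "[]" "[]"] show "\<phi> v = \<phi> w" by simp
qed

lemma weq_gg: "1 \<le> i \<Longrightarrow> 1 \<le> j \<Longrightarrow> i + 1 < j \<or> j + 1 < i \<Longrightarrow> weq d u [YG i, YG j] [YG j, YG i]"
  by (rule weq_binomial_relation) (auto simp: Y_rels_def)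

lemma weq_braid: "1 \<le> i \<Longrightarrow> weq d u [YG (Suc i), YG i, YG (Suc i)] [YG i, YG (Suc i), YG i]"
  by (rule weq_binomial_relation) (auto simp: Y_rels_def)

lemma weq_tt: "1 \<le> i \<Longrightarrow> 1 \<le> j \<Longrightarrow> weq d u [YT i, YT j] [YT j, YT i]"
  by (rule weq_binomial_relation) (auto simp: Y_rels_def)

lemma weq_tpow_d: "1 \<le> i \<Longrightarrow> weq d u (tpow i d) []"
  by (rule weq_binomial_relation) (auto simp: Y_rels_def)

section \<open>Monomials in the \<open>t_j\<close> and how they pass the \<open>g_i\<close>\<close>

fun swap_gen :: "nat \<Rightarrow> ygen \<Rightarrow> ygen" where
  "swap_gen i (YT j) = YT (if j = i then Suc i else if j = Suc i then i else j)"
| "swap_gen i (YG j) = YG j"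

text \<open>Uniform form of the three mixed relations: conjugation by \<open>g_i\<close> permutes
  the indices of the \<open>t_j\<close> by the transposition s_i.\<close>

lemma weq_gt: "1 \<le> i \<Longrightarrow> 1 \<le> j \<Longrightarrow> weq d u [YG i, YT j] [swap_gen i (YT j), YG i]"
  by (rule weq_binomial_relation) (auto simp: Y_rels_def)

definition tword :: "yword \<Rightarrow> bool" where
  "tword w \<longleftrightarrow> (\<forall>a\<in>set w. \<exists>j\<ge>1. a = YT j)"

lemma tword_simps [simp]:
  "tword []" "tword (a # w) \<longleftrightarrow> (\<exists>j\<ge>1. a = YT j) \<and> tword w"
  "tword (v @ w) \<longleftrightarrow> tword v \<and> tword w" "1 \<le> i \<Longrightarrow> tword (tpow i k)"
  by (auto simp: tword_def tpow_def)

lemma mset_tpow [simp]: "mset (tpow i k) = replicate_mset k (YT i)"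
  by (simp add: tpow_def)

lemma map_swap_gen_tpow [simp]:
  "map (swap_gen i) (tpow j k) = tpow (if j = i then Suc i else if j = Suc i then i else j) k"
  by (simp add: tpow_def)

lemma tpow_add: "tpow i (a + b) = tpow i a @ tpow i b"
  by (simp add: tpow_def replicate_add)

lemma tpow_0 [simp]: "tpow i 0 = []"
  by (simp add: tpow_def)

lemma tpow_Suc: "tpow i (Suc k) = YT i # tpow i k"
  by (simp add: tpow_def)

lemma weq_g_tword: "1 \<le> i \<Longrightarrow> tword w \<Longrightarrow> weq d u (YG i # w) (map (swap_gen i) w @ [YG i])"
proof (induction w)
  case (Cons a w)
  then obtain j where j: "a = YT j" "1 \<le> j" by auto
  have "weq d u (YG i # a # w) (swap_gen i a # YG i # w)"
    using weq_context[OF weq_gt[OF Cons.prems(1) j(2)], of d u "[]" w] j by simp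
  also have "weq d u \<dots> (swap_gen i a # map (swap_gen i) w @ [YG i])"
    using Cons by (intro weq_Cons) auto
  finally show ?case by simp
qed simp

lemma weq_t_front: "tword w \<Longrightarrow> 1 \<le> j \<Longrightarrow> weq d u (w @ [YT j]) (YT j # w)"
proof (induction w)
  case (Cons a w)
  then obtain i where i: "a = YT i" "1 \<le> i" by auto
  have "weq d u (a # w @ [YT j]) (a # YT j # w)"
    using Cons by (intro weq_Cons) auto
  also have "weq d u \<dots> (YT j # a # w)"
    using weq_context[OF weq_tt[OF i(2) Cons.prems(2)], of d u "[]" w] i by simp
  finally show ?case by simp
qed simp

text \<open>The \<open>t_j\<close> commute, so only the multiset of letters matters. Later
  rearrangements of exponents thus become simplifications of multisets.\<close>

lemma weq_tword_perm: "tword v \<Longrightarrow> mset v = mset w \<Longrightarrow> weq d u v w"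
proof (induction w arbitrary: v)
  case (Cons a w)
  then have "a \<in> set v" by (metis list.set_intros(1) mset_eq_setD)
  then obtain v1 v2 where v: "v = v1 @ a # v2" by (meson split_list)
  from Cons.prems(1) v obtain j where j: "a = YT j" "1 \<le> j" by auto
  have "weq d u v (a # v1 @ v2)"
    using weq_context[OF weq_t_front[of v1 j d u], of "[]" v2] Cons.prems(1) v j by simp
  also have "weq d u \<dots> (a # w)"
  proof (rule weq_Cons, rule Cons.IH)
    show "tword (v1 @ v2)" using Cons.prems(1) v by simp
    show "mset (v1 @ v2) = mset w" using Cons.prems(2) v by simp
  qed
  finally show ?case .
qed simp

lemma weq_tpow_mod: assumes "1 \<le> i" shows "weq d u (tpow i k) (tpow i (k mod d))"
proof -
  have "weq d u (tpow i (d * q + r)) (tpow i r)" for q r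
  proof (induction q)
    case (Suc q)
    have "weq d u (tpow i d @ tpow i (d * q + r)) ([] @ tpow i r)"
      by (intro weq_append weq_tpow_d assms Suc)
    then show ?case by (simp add: tpow_add[symmetric] algebra_simps)
  qed simp
  from this[of "k div d" "k mod d"] show ?thesis by simp
qed

section \<open>Words of \<open>Y_n\<close> and letters commuting with them\<close>

lemma in_Y_simps [simp]:
  "in_Y n []" "in_Y n (v @ w) \<longleftrightarrow> in_Y n v \<and> in_Y n w"
  "in_Y n (YG i # w) \<longleftrightarrow> 1 \<le> i \<and> i < n \<and> in_Y n w"
  "in_Y n (YT i # w) \<longleftrightarrow> 1 \<le> i \<and> i \<le> n \<and> in_Y n w"
  by (auto simp: in_Y_def)

lemma in_Y_tpow [simp]: "1 \<le> i \<Longrightarrow> i \<le> n \<Longrightarrow> in_Y n (tpow i k)"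
  by (auto simp: in_Y_def tpow_def)

lemma in_Y_mono: "in_Y n w \<Longrightarrow> n \<le> m \<Longrightarrow> in_Y m w"
  by (fastforce simp: in_Y_def split: ygen.splits)

lemma weq_t_comm: "in_Y n a \<Longrightarrow> n < m \<Longrightarrow> weq d u (YT m # a) (a @ [YT m])"
proof (induction a)
  case (Cons l a)
  have "weq d u [YT m, l] [l, YT m]"
  proof (cases l)
    case (YG i)
    with Cons.prems weq_gt[of i m d u] show ?thesis by (auto dest: weq_sym)
  next
    case (YT i)
    with Cons.prems show ?thesis by (auto intro: weq_tt)
  qed
  from weq_context[OF this, of "[]" a] have "weq d u (YT m # l # a) (l # YT m # a)" by simp
  also have "weq d u \<dots> (l # a @ [YT m])"
    using Cons by (intro weq_Cons Cons.IH) (cases l; auto)+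
  finally show ?case by simp
qed simp

lemma weq_tpow_comm: "in_Y n a \<Longrightarrow> n < m \<Longrightarrow> weq d u (tpow m k @ a) (a @ tpow m k)"
proof (induction k)
  case (Suc k)
  have "weq d u (YT m # tpow m k @ a) (YT m # a @ tpow m k)"
    by (intro weq_Cons Suc)
  also have "weq d u \<dots> ((a @ [YT m]) @ tpow m k)"
    using weq_context[OF weq_t_comm[OF Suc.prems, of d u], of "[]" "tpow m k"] by simp
  finally show ?case by (simp add: tpow_Suc)
qed simp

text \<open>The letters of \<open>a\<close> are \<open>g_i\<close> with i < n < m, hence i + 1 < m,
  and \<open>t_j\<close> with j <= n < m; each commutes with \<open>g_m\<close>.\<close>

lemma weq_g_comm: "in_Y n a \<Longrightarrow> n < m \<Longrightarrow> weq d u (YG m # a) (a @ [YG m])"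
proof (induction a)
  case (Cons l a)
  have "weq d u [YG m, l] [l, YG m]"
  proof (cases l)
    case (YG i)
    with Cons.prems show ?thesis by (auto intro!: weq_gg)
  next
    case (YT i)
    with Cons.prems weq_gt[of m i d u] show ?thesis by auto
  qed
  from weq_context[OF this, of "[]" a] have "weq d u (YG m # l # a) (l # YG m # a)" by simp
  also have "weq d u \<dots> (l # a @ [YG m])"
    using Cons by (intro weq_Cons Cons.IH) (cases l; auto)+
  finally show ?case by simp
qed simp

subsection \<open>The spanning set and invertibility\<close>

text \<open>The exponent k = 0 is included, so such a functional also vanishes on \<open>Y_n\<close>
  itself. The guard on n excludes \<open>g_0\<close>, which is no generator.\<close>

definition kills_span :: "nat \<Rightarrow> (yword \<Rightarrow> complex) \<Rightarrow> bool" where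
  "kills_span n \<phi> \<longleftrightarrow> (\<forall>a b. in_Y n a \<longrightarrow> in_Y n b \<longrightarrow>
     (1 \<le> n \<longrightarrow> \<phi> (a @ [YG n] @ b) = 0) \<and> (\<forall>k. \<phi> (a @ tpow (Suc n) k @ b) = 0))"

lemma kills_spanD:
  assumes "kills_span n \<phi>" "in_Y n a" "in_Y n b"
  shows "1 \<le> n \<Longrightarrow> \<phi> (a @ YG n # b) = 0" and "\<phi> (a @ tpow (Suc n) k @ b) = 0"
  using assms by (auto simp: kills_span_def)

text \<open>Dual form of the closure of the span under left multiplication by a letter of
  \<open>Y_{n+1}\<close>. The hypothesis \<open>IH\<close> is the spanning statement for
  \<open>Y_n\<close>, supplied by the induction that uses this lemma.\<close>

lemma kills_span_prefix_letter:
  assumes "Yfun d u \<phi>" and "kills_span n \<phi>" and "in_Y (Suc n) [l]"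
    and IH: "\<And>m \<psi> a. n = Suc m \<Longrightarrow> Yfun d u \<psi> \<Longrightarrow> kills_span m \<psi> \<Longrightarrow> in_Y n a \<Longrightarrow> \<psi> a = 0"
  shows "kills_span n (\<lambda>y. \<phi> (l # y))"
proof -
  have Y: "Yfun d u (\<lambda>y. \<phi> (a @ y @ b))" for a b
    using assms(1) by (rule Yfun_context)
  consider "in_Y n [l]" | "l = YT (Suc n)" | "l = YG n" "1 \<le> n"
    using assms(3) by (cases l) force+
  then show ?thesis
  proof cases
    case 1
    then show ?thesis
      using kills_spanD[OF assms(2), of "l # _"] by (cases l) (auto simp: kills_span_def)
  next
    case 2
    have t: "\<phi> (l # a @ y) = \<phi> (a @ YT (Suc n) # y)" if "in_Y n a" for a y
      using weqD[OF weq_t_comm[OF that, of "Suc n" d u] Y[of "[]" y]] 2 by simp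
    have "\<phi> (l # a @ YG n # b) = 0" if "in_Y n a" "in_Y n b" "1 \<le> n" for a b
    proof -
      have "\<phi> (a @ YT (Suc n) # YG n # b) = \<phi> (a @ YG n # YT n # b)"
        using weqD[OF weq_gt[of n n d u] Y[of a b]] that by simp
      also have "\<dots> = 0"
        using kills_spanD(1)[OF assms(2), of a "YT n # b"] that by simp
      finally show ?thesis using t that by simp
    qed
    moreover have "\<phi> (l # a @ tpow (Suc n) k @ b) = 0" if "in_Y n a" "in_Y n b" for a b k
      using t[OF that(1), of "tpow (Suc n) k @ b"] kills_spanD(2)[OF assms(2) that, of "Suc k"]
      by (simp add: tpow_Suc)
    ultimately show ?thesis by (simp add: kills_span_def)
  next
    \<comment> \<open>With m = n - 1, \<open>IH\<close> splits the word between \<open>g_n\<close>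
      and the next special letter at \<open>g_m\<close> or at a power of \<open>t_n\<close>; the
      outer pieces lie in \<open>Y_m\<close> and commute with \<open>g_n\<close>.\<close>
    case 3
    then obtain m where n: "n = Suc m" by (cases n) auto
    have g: "\<phi> (v @ YG n # a @ y) = \<phi> (v @ a @ YG n # y)" if "in_Y m a" for v a y
      using weqD[OF weq_g_comm[OF that, of n d u] Y[of v y]] n by simp
    have gt: "\<phi> (v @ YG n # w @ y) = \<phi> (v @ map (swap_gen n) w @ YG n # y)" if "tword w" for v w y
      using weqD[OF weq_g_tword[of n w d u] Y[of v y]] that n by simp
    have tt: "\<phi> (v @ w @ y) = \<phi> (v @ w' @ y)" if "tword w" "mset w = mset w'" for v w w' y
      using weqD[OF weq_tword_perm[OF that, of d u] Y[of v y]] by simp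
    have tgt: "\<phi> (a @ tpow (Suc n) j @ tpow n l @ YG n # b) = 0"
      if "in_Y n a" "in_Y n b" for a b j l
    proof -
      have "\<phi> (a @ tpow (Suc n) j @ tpow n l @ YG n # b)
          = \<phi> (a @ (tpow n l @ tpow (Suc n) j) @ YG n # b)"
        using tt[of "tpow (Suc n) j @ tpow n l" "tpow n l @ tpow (Suc n) j" a "YG n # b"] n by simp
      also have "\<dots> = \<phi> ((a @ tpow n l) @ YG n # tpow n j @ b)"
        using gt[of "tpow n j" "a @ tpow n l" b] n by simp
      also have "\<dots> = 0"
        using kills_spanD(1)[OF assms(2), of "a @ tpow n l" "tpow n j @ b"] that n by simp
      finally show ?thesis .
    qed
    have G: "\<phi> (YG n # a @ YG n # b) = 0" if ab: "in_Y n a" "in_Y n b" for a b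
    proof -
      have "Yfun d u (\<lambda>a. \<phi> (YG n # a @ YG n # b))" using Y[of "[YG n]" "YG n # b"] by simp
      moreover have "kills_span m (\<lambda>a. \<phi> (YG n # a @ YG n # b))"
        unfolding kills_span_def
      proof (intro allI impI conjI)
        fix a' b' assume ab': "in_Y m a'" "in_Y m b'"
        then have abn: "in_Y n a'" "in_Y n b'" using n by (auto elim: in_Y_mono)
        \<comment> \<open>The braid relation leaves a single \<open>g_n\<close>.\<close>
        show "\<phi> (YG n # (a' @ [YG m] @ b') @ YG n # b) = 0" if "1 \<le> m"
        proof -
          have "\<phi> (YG n # a' @ YG m # b' @ YG n # b) = \<phi> (a' @ YG n # YG m # YG n # b' @ b)"
            using g[OF ab'(1), of "[]"] g[OF ab'(2), of "a' @ [YG n, YG m]" b] by simp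
          also have "\<dots> = \<phi> (a' @ YG m # YG n # YG m # b' @ b)"
            using weqD[OF weq_braid[OF that, of d u] Y[of a' "b' @ b"]] n by simp
          also have "\<dots> = 0"
            using kills_spanD(1)[OF assms(2), of "a' @ [YG m]" "YG m # b' @ b"] that ab abn n by simp
          finally show ?thesis by simp
        qed
        show "\<phi> (YG n # (a' @ tpow (Suc m) k @ b') @ YG n # b) = 0" for k
        proof -
          have "\<phi> (YG n # a' @ tpow n k @ b' @ YG n # b)
              = \<phi> (a' @ YG n # tpow n k @ YG n # b' @ b)"
            using g[OF ab'(1), of "[]"] g[OF ab'(2), of "a' @ YG n # tpow n k" b] by simp
          also have "\<dots> = \<phi> ((a' @ tpow (Suc n) k) @ YG n # YG n # b' @ b)"
            using gt[of "tpow n k" a'] n by simp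
          also have "\<dots> = 0"
          proof -
            \<comment> \<open>The terms of the quadratic relation for \<open>g_n g_n\<close>: those
              of \<open>e_n\<close> (1), of \<open>e_n g_n\<close> (2), and the unit (3).\<close>
            have 1: "\<phi> (a' @ tpow (Suc n) k @ tpow n s @ tpow (Suc n) r @ b' @ b) = 0" for s r
              using tt[of "tpow (Suc n) k @ tpow n s @ tpow (Suc n) r"
                  "tpow n s @ tpow (Suc n) (k + r)" a' "b' @ b"]
                kills_spanD(2)[OF assms(2), of "a' @ tpow n s" "b' @ b" "k + r"] ab abn n
              by (simp add: repeat_mset_distrib tpow_add)
            have 2: "\<phi> (a' @ tpow (Suc n) k @ tpow n s @ tpow (Suc n) r @ YG n # b' @ b) = 0" for s r
              using tt[of "tpow (Suc n) k @ tpow n s @ tpow (Suc n) r"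
                  "tpow (Suc n) (k + r) @ tpow n s" a' "YG n # b' @ b"]
                tgt[of a' "b' @ b" "k + r" s] ab abn n
              by (simp add: tpow_add)
            have 3: "\<phi> (a' @ tpow (Suc n) k @ b' @ b) = 0"
              using 1[of 0 0] by simp
            show ?thesis
              using Yfun_quadratic[OF assms(1) \<open>1 \<le> n\<close>, of "a' @ tpow (Suc n) k" "b' @ b"] 1 2 3 n by simp
          qed
          finally show ?thesis using n by simp
        qed
      qed
      ultimately show ?thesis using IH[OF n _ _ ab(1)] by blast
    qed
    moreover have "\<phi> (YG n # a @ tpow (Suc n) k @ b) = 0" if ab: "in_Y n a" "in_Y n b" for a b k
    proof -
      have "Yfun d u (\<lambda>a. \<phi> (YG n # a @ tpow (Suc n) k @ b))"
        using Y[of "[YG n]" "tpow (Suc n) k @ b"] by simp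
      moreover have "kills_span m (\<lambda>a. \<phi> (YG n # a @ tpow (Suc n) k @ b))"
        unfolding kills_span_def
      proof (intro allI impI conjI)
        fix a' b' assume ab': "in_Y m a'" "in_Y m b'"
        then have abn: "in_Y n a'" "in_Y n b'" using n by (auto elim: in_Y_mono)
        \<comment> \<open>Brings \<open>t_{n+1}^k\<close> next to the left \<open>g_n\<close>, which
          it then passes as \<open>t_n^k\<close>.\<close>
        have tb: "\<phi> (v @ tpow (Suc n) k @ a @ y) = \<phi> (v @ a @ tpow (Suc n) k @ y)"
          if "in_Y n a" for v a y
          using weqD[OF weq_tpow_comm[OF that, of "Suc n" d u k] Y[of v y]] by simp
        show "\<phi> (YG n # (a' @ [YG m] @ b') @ tpow (Suc n) k @ b) = 0" if "1 \<le> m"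
        proof -
          have "\<phi> (YG n # (a' @ [YG m] @ b') @ tpow (Suc n) k @ b)
              = \<phi> (a' @ YG n # tpow (Suc n) k @ YG m # b' @ b)"
            using g[OF ab'(1), of "[]"] tb[of "YG m # b'" "a' @ [YG n]" b] abn n that by simp
          also have "\<dots> = \<phi> (a' @ tpow n k @ YG n # YG m # b' @ b)"
            using gt[of "tpow (Suc n) k" a'] n by simp
          also have "\<dots> = 0"
            using kills_spanD(1)[OF assms(2), of "a' @ tpow n k" "YG m # b' @ b"] that ab abn n by simp
          finally show ?thesis .
        qed
        show "\<phi> (YG n # (a' @ tpow (Suc m) j @ b') @ tpow (Suc n) k @ b) = 0" for j
        proof -
          have "\<phi> (YG n # (a' @ tpow (Suc m) j @ b') @ tpow (Suc n) k @ b)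
              = \<phi> (a' @ YG n # (tpow n j @ tpow (Suc n) k) @ b' @ b)"
            using g[OF ab'(1), of "[]"] tb[of "b'" "a' @ YG n # tpow n j" b] abn n by simp
          also have "\<dots> = \<phi> (a' @ tpow (Suc n) j @ tpow n k @ YG n # b' @ b)"
            using gt[of "tpow n j @ tpow (Suc n) k" a' "b' @ b"] n by simp
          also have "\<dots> = 0" using tgt[of a' "b' @ b" j k] ab abn by simp
          finally show ?thesis .
        qed
      qed
      ultimately show ?thesis using IH[OF n _ _ ab(1)] by blast
    qed
    ultimately show ?thesis using 3 by (simp add: kills_span_def)
  qed
qed

text \<open>Dual form of the fact that \<open>Y\<^bsub>n+1\<^esub>\<close> is spanned by \<open>a g\<^sub>n b\<close> and \<open>a t\<^bsub>n+1\<^esub>\<^sup>k b\<close>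
  with \<open>a\<close>, \<open>b\<close> in \<open>Y\<^sub>n\<close>.\<close>
lemma kills_span_imp_zero:
  "Yfun d u \<phi> \<Longrightarrow> kills_span n \<phi> \<Longrightarrow> in_Y (Suc n) w \<Longrightarrow> \<phi> w = 0"
proof (induction n arbitrary: \<phi> w rule: less_induct)
  case (less n)
  \<comment> \<open>The letters of \<open>w\<close> are absorbed into the functional one at a time;
    exponent 0 with empty \<open>a\<close> and \<open>b\<close> finally evaluates it at
    \<open>w\<close>.\<close>
  have "kills_span n (\<lambda>y. \<phi> (w @ y))"
    using less.prems
  proof (induction w arbitrary: \<phi>)
    case (Cons l w)
    have l: "in_Y (Suc n) [l]" "in_Y (Suc n) w" using Cons.prems(3) by (cases l; simp)+
    have "kills_span n (\<lambda>y. \<phi> (l # y))"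
      by (rule kills_span_prefix_letter[OF Cons.prems(1,2) l(1)]) (auto intro: less.IH)
    from Cons.IH[OF _ this l(2)] show ?case
      using Yfun_prefix[OF Cons.prems(1), of "[l]"] by simp
  qed simp
  from kills_spanD(2)[OF this, of "[]" "[]" 0] show ?case by simp
qed

text \<open>With \<open>E m = \<psi> (e\<^sub>j m)\<close>, the quadratic relation gives \<open>\<psi> m + (u - 1) E m = 0\<close>; replacing \<open>m\<close> by
  \<open>e\<^sub>j m\<close> yields \<open>u E m = 0\<close>.\<close>
lemma g_cancel:
  assumes "Yfun d u \<psi>" and "u \<noteq> 0" and "1 \<le> d" and j: "1 \<le> j" "j < n"
    and z: "\<And>m. in_Y n m \<Longrightarrow> \<psi> (YG j # m) = 0" and m: "in_Y n m"
  shows "\<psi> m = 0"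
proof -
  have Y: "Yfun d u (\<lambda>y. \<psi> (a @ y @ b))" for a b
    using assms(1) by (rule Yfun_context)
  define E where "E m = (\<Sum>s<d. \<psi> (tpow j s @ tpow (Suc j) (d - s) @ m)) / of_nat d" for m
  have *: "\<psi> m + (u - 1) * E m = 0" if m: "in_Y n m" for m
  proof -
    \<comment> \<open>Moving \<open>g_j\<close> to the front exchanges the two exponents and makes
      \<open>z\<close> applicable, so the term with \<open>e_j g_j\<close> drops out.\<close>
    have "\<psi> (tpow j s @ tpow (Suc j) (d - s) @ YG j # m) = 0" for s
      using weqD[OF weq_g_tword[of j "tpow (Suc j) s @ tpow j (d - s)" d u] Y[of "[]" m]] j m
        z[of "tpow (Suc j) s @ tpow j (d - s) @ m"] by simp
    with Yfun_quadratic[OF assms(1) j(1), of "[]" m] z[of "YG j # m"] m j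
    show ?thesis by (simp add: E_def)
  qed
  have red: "\<psi> (tpow j s @ tpow (Suc j) r @ m) = \<psi> (tpow j (s mod d) @ tpow (Suc j) (r mod d) @ m)"
    for s r m
    using weqD[OF weq_append[OF weq_tpow_mod[of j d u s] weq_tpow_mod[of "Suc j" d u r]]
        Y[of "[]" m]] j by simp
  \<comment> \<open>\<open>e_j\<close> absorbs \<open>t_j^r t_{j+1}^{d-r}\<close>: shifting s by r
    modulo d permutes its summands.\<close>
  have E2: "E (tpow j r @ tpow (Suc j) (d - r) @ m) = E m" if "r < d" for r
  proof -
    have "(\<Sum>s<d. \<psi> (tpow j s @ tpow (Suc j) (d - s) @ tpow j r @ tpow (Suc j) (d - r) @ m))
        = (\<Sum>s<d. \<psi> (tpow j s @ tpow (Suc j) (d - s) @ m))"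
    proof (rule sum.reindex_bij_witness[of _ "\<lambda>s. (s + (d - r)) mod d" "\<lambda>s. (s + r) mod d"])
      fix s assume s: "s \<in> {..<d}"
      show "((s + r) mod d + (d - r)) mod d = s" "((s + (d - r)) mod d + r) mod d = s"
        unfolding mod_add_left_eq using s that by simp_all
      have "\<psi> (tpow j s @ tpow (Suc j) (d - s) @ tpow j r @ tpow (Suc j) (d - r) @ m)
          = \<psi> (tpow j (s + r) @ tpow (Suc j) ((d - s) + (d - r)) @ m)"
        using weqD[OF weq_tword_perm[of "tpow j s @ tpow (Suc j) (d - s) @ tpow j r @ tpow (Suc j) (d - r)"
            "tpow j (s + r) @ tpow (Suc j) ((d - s) + (d - r))" d u] Y[of "[]" m]] j
        by (simp add: tpow_add)
      also have "\<dots> = \<psi> (tpow j ((s + r) mod d) @ tpow (Suc j) (d - (s + r) mod d) @ m)"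
      proof -
        have "((d - s) + (d - r)) mod d = (d - (s + r) mod d) mod d"
        proof (cases "s + r < d")
          case True
          then have "(d - s) + (d - r) = (d - (s + r)) + d" by simp
          then show ?thesis using True by (metis mod_add_self2 mod_less)
        next
          case False
          then have "(s + r) mod d = s + r - d" using s that by (simp add: mod_if)
          then show ?thesis using False s that by simp
        qed
        then show ?thesis
          using red[of "s + r" "(d - s) + (d - r)"] red[of "(s + r) mod d" "d - (s + r) mod d"] by simp
      qed
      finally show "\<psi> (tpow j ((s + r) mod d) @ tpow (Suc j) (d - (s + r) mod d) @ m)
          = \<psi> (tpow j s @ tpow (Suc j) (d - s) @ tpow j r @ tpow (Suc j) (d - r) @ m)" by simp
    qed (use assms(3) in auto)
    then show ?thesis by (simp add: E_def)
  qed
  \<comment> \<open>Summing over r inserts \<open>e_j\<close> up to the factor d.\<close>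
  have "(\<Sum>r<d. \<psi> (tpow j r @ tpow (Suc j) (d - r) @ m) + (u - 1) * E m) = 0"
  proof (rule sum.neutral, safe)
    fix r assume "r < d"
    then show "\<psi> (tpow j r @ tpow (Suc j) (d - r) @ m) + (u - 1) * E m = 0"
      using *[of "tpow j r @ tpow (Suc j) (d - r) @ m"] E2[of r] m j by simp
  qed
  then have "of_nat d * E m + of_nat d * ((u - 1) * E m) = 0"
    using assms(3) by (simp add: sum.distrib E_def)
  then have "of_nat d * (u * E m) = 0" by (simp add: algebra_simps)
  then have "E m = 0" using assms(2,3) by simp
  with *[OF m] show ?thesis by simp
qed

subsection \<open>The elements \<open>r\<^bsub>i,i+1\<^esub>\<close>\<close>

text \<open>Exponents of the coset of t_i^k modulo the subgroup generated by t_i t_{i+1}^{-1} and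
  t_{i+1} t_{i+2}^{-1}. Only the total degree modulo d counts, so the three places are
  interchangeable.\<close>

definition triples :: "nat \<Rightarrow> nat \<Rightarrow> (nat \<times> nat \<times> nat) set" where
  "triples d k = {(a, b, c). a < d \<and> b < d \<and> c < d \<and> (a + b + c) mod d = k mod d}"

lemma finite_triples [simp]: "finite (triples d k)"
  by (rule finite_subset[of _ "{..<d} \<times> {..<d} \<times> {..<d}"]) (auto simp: triples_def)

fun tmon :: "nat \<Rightarrow> nat \<times> nat \<times> nat \<Rightarrow> yword" where
  "tmon i (a, b, c) = tpow i a @ tpow (Suc i) b @ tpow (Suc (Suc i)) c"

text \<open>The value of \<open>\<phi>\<close> at \<open>t\<^sub>i\<^sup>k r\<^bsub>i,i+1\<^esub>\<close>, with the exponents of \<open>t\<close> written symmetrically.\<close>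
definition Rsum :: "nat \<Rightarrow> nat \<Rightarrow> nat \<Rightarrow> (yword \<Rightarrow> complex) \<Rightarrow> complex" where
  "Rsum d i k \<phi> = (\<Sum>p\<in>triples d k. \<Sum>g\<leftarrow>g_sym3 i. \<phi> (tmon i p @ g))"

lemma Rsum_mod: "Rsum d i (k mod d) = Rsum d i k"
  by (simp add: Rsum_def triples_def fun_eq_iff)

lemma sum_list_concat_map: "sum_list (map h (concat (map f xs))) = (\<Sum>x\<leftarrow>xs. sum_list (map h (f x)))"
  for h :: "'b \<Rightarrow> 'c::monoid_add"
  by (induction xs) auto

lemma sum_list_upt: "(\<Sum>x\<leftarrow>[0..<d]. f x) = sum f {..<d}" for f :: "nat \<Rightarrow> complex"
  by (simp add: interv_sum_list_conv_sum_set_nat atLeast0LessThan)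

lemma lc_eval_r_lc:
  assumes "1 \<le> d"
  shows "lc_eval \<phi> (r_lc d i) = Rsum d i 0 \<phi>"
proof -
  define f where "f p = (\<Sum>g\<leftarrow>g_sym3 i. \<phi> (tmon i p @ g))" for p
  have "lc_eval \<phi> (r_lc d i)
      = (\<Sum>a<d. \<Sum>b<d. f (a, nat ((int b - int a) mod int d), nat ((- int b) mod int d)))"
    unfolding lc_eval_def r_lc_def f_def
    by (simp add: sum_list_concat_map sum_list_upt comp_def)
  also have "\<dots> = (\<Sum>(a, b)\<in>{..<d} \<times> {..<d}.
      f (a, nat ((int b - int a) mod int d), nat ((- int b) mod int d)))"
    by (simp add: sum.cartesian_product)
  also have "\<dots> = sum f (triples d 0)"
  proof -
    \<comment> \<open>(a, b) corresponds to the exponents (a, b - a, - b) modulo d, and b is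
      recovered as the sum of the first two.\<close>
    define I where "I = (\<lambda>(a, b, c :: nat). (a, (a + b) mod d))"
    define J where "J = (\<lambda>(a, b). (a, nat ((int b - int a) mod int d), nat ((- int b) mod int d)))"
    have *: "I p \<in> {..<d} \<times> {..<d} \<and> J (I p) = p" if p: "p \<in> triples d 0" for p
    proof -
      obtain a b c where [simp]: "p = (a, b, c)" by (cases p) auto
      from p have abc: "a < d" "b < d" "c < d" "(a + b + c) mod d = 0" by (auto simp: triples_def)
      have 1: "(int ((a + b) mod d) - int a) mod int d = int b"
        using abc by (simp add: zmod_int mod_simps)
      have "(- int ((a + b) mod d)) mod int d = (int c - int (a + b + c)) mod int d"
        by (simp add: zmod_int mod_simps)
      also have "\<dots> = (int c - int ((a + b + c) mod d)) mod int d"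
        unfolding zmod_int by (rule mod_diff_right_eq[symmetric])
      finally show ?thesis using 1 abc by (simp add: I_def J_def)
    qed
    have **: "J q \<in> triples d 0 \<and> I (J q) = q" if q: "q \<in> {..<d} \<times> {..<d}" for q
    proof -
      obtain a b where [simp]: "q = (a, b)" by (cases q) auto
      from q have ab: "a < d" "b < d" by auto
      have "int ((a + nat ((int b - int a) mod int d)) mod d) = int b"
        using ab by (simp add: zmod_int mod_simps)
      then have 1: "(a + nat ((int b - int a) mod int d)) mod d = b" by simp
      have "int ((b + nat ((- int b) mod int d)) mod d) = 0"
        using ab by (simp add: zmod_int mod_simps)
      then have "(a + nat ((int b - int a) mod int d) + nat ((- int b) mod int d)) mod d = 0"
        using 1 by (metis mod_add_left_eq of_nat_eq_0_iff)
      with 1 show ?thesis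
        using ab by (auto simp: triples_def I_def J_def nat_less_iff)
    qed
    show ?thesis
      by (rule sum.reindex_bij_witness[of _ I J]) (use * ** in \<open>auto simp: J_def\<close>)
  qed
  finally show ?thesis by (simp add: Rsum_def f_def)
qed

section \<open>Letters acting on the sums of t-monomials\<close>

lemma triples_swap:
  "sum (\<lambda>(a, b, c). f (b, a, c)) (triples d k) = sum f (triples d k)"
  "sum (\<lambda>(a, b, c). f (a, c, b)) (triples d k) = sum f (triples d k)"
  by (rule sum.reindex_bij_witness[of _ "\<lambda>(a, b, c). (b, a, c)" "\<lambda>(a, b, c). (b, a, c)"];
      force simp: triples_def add.commute add.left_commute)
     (rule sum.reindex_bij_witness[of _ "\<lambda>(a, b, c). (a, c, b)" "\<lambda>(a, b, c). (a, c, b)"];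
      force simp: triples_def add.commute add.left_commute)

text \<open>Multiplication by \<open>t_i\<close> raises the total degree by one; adding d - 1 modulo
  d undoes it.\<close>

lemma triples_Suc:
  assumes "1 \<le> d"
  shows "sum (\<lambda>(a, b, c). f (Suc a mod d, b, c)) (triples d k) = sum f (triples d (Suc k))"
proof -
  define I where "I = (\<lambda>(a, b :: nat, c :: nat). ((a + (d - 1)) mod d, b, c))"
  define J where "J = (\<lambda>(a, b :: nat, c :: nat). (Suc a mod d, b, c))"
  have *: "J p \<in> triples d (Suc k) \<and> I (J p) = p" if p: "p \<in> triples d k" for p
  proof -
    obtain a b c where [simp]: "p = (a, b, c)" by (cases p) auto
    from p have abc: "a < d" "b < d" "c < d" "(a + b + c) mod d = k mod d" by (auto simp: triples_def)
    have 1: "(Suc a mod d + (d - 1)) mod d = (Suc a + (d - 1)) mod d" by (rule mod_add_left_eq)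
    have "(Suc a mod d + b + c) mod d = Suc (a + b + c) mod d"
      unfolding add.assoc mod_add_left_eq by simp
    also have "\<dots> = Suc k mod d"
      using abc(4) by (metis mod_Suc_eq)
    finally show ?thesis using 1 abc by (simp add: triples_def I_def J_def)
  qed
  have **: "I p \<in> triples d k \<and> J (I p) = p" if p: "p \<in> triples d (Suc k)" for p
  proof -
    obtain a b c where [simp]: "p = (a, b, c)" by (cases p) auto
    from p have abc: "a < d" "b < d" "c < d" "(a + b + c) mod d = Suc k mod d"
      by (auto simp: triples_def)
    have 1: "Suc ((a + (d - 1)) mod d) mod d = Suc (a + (d - 1)) mod d" by (rule mod_Suc_eq)
    have "((a + (d - 1)) mod d + b + c) mod d = ((a + b + c) + (d - 1)) mod d"
      unfolding add.assoc mod_add_left_eq by (simp add: ac_simps)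
    also have "\<dots> = (Suc k mod d + (d - 1)) mod d"
      unfolding abc(4)[symmetric] by (rule mod_add_left_eq[symmetric])
    also have "\<dots> = (Suc k + (d - 1)) mod d" by (rule mod_add_left_eq)
    also have "\<dots> = k mod d" using assms by simp
    finally show ?thesis using 1 abc by (simp add: triples_def I_def J_def)
  qed
  show ?thesis
    by (rule sum.reindex_bij_witness[of _ I J]) (use * ** in \<open>auto simp: J_def\<close>)
qed

lemma tmon_mod:
  assumes "Yfun d u \<phi>" "1 \<le> i"
  shows "\<phi> (tmon i (a, b, c) @ w) = \<phi> (tmon i (a mod d, b mod d, c mod d) @ w)"
proof -
  have "weq d u (tmon i (a, b, c)) (tmon i (a mod d, b mod d, c mod d))"
    using assms(2) by (auto intro!: weq_append weq_tpow_mod)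
  from weqD[OF this Yfun_suffix[OF assms(1)]] show ?thesis .
qed

text \<open>Each of the three letters raises the total degree by one; swaps carry the affected
  exponent to the first place, where \<open>triples_Suc\<close> applies.\<close>

lemma t_tmon:
  assumes Y: "Yfun d u \<phi>" and "1 \<le> i" "1 \<le> d" and j: "i \<le> j" "j \<le> i + 2"
  shows "(\<Sum>p\<in>triples d k. \<phi> (YT j # tmon i p @ w)) = (\<Sum>p\<in>triples d (Suc k). \<phi> (tmon i p @ w))"
proof -
  note S = triples_Suc[OF assms(3)]
  have perm: "\<phi> (v @ w) = \<phi> (v' @ w)" if "tword v" "mset v = mset v'" for v v'
    using weqD[OF weq_tword_perm[OF that] Yfun_suffix[OF Y]] .
  have lt: "a < d" "b < d" "c < d" if "(a, b, c) \<in> triples d k" for a b c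
    using that by (auto simp: triples_def)
  consider "j = i" | "j = Suc i" | "j = Suc (Suc i)" using j by linarith
  then show ?thesis
  proof cases
    case 1
    have "(\<Sum>p\<in>triples d k. \<phi> (YT j # tmon i p @ w))
        = (\<Sum>(a, b, c)\<in>triples d k. \<phi> (tmon i (Suc a mod d, b, c) @ w))"
    proof (rule sum.cong[OF refl], clarify)
      fix a b c assume "(a, b, c) \<in> triples d k"
      then show "\<phi> (YT j # tmon i (a, b, c) @ w) = \<phi> (tmon i (Suc a mod d, b, c) @ w)"
        using tmon_mod[OF Y assms(2), of "Suc a" b c w] lt 1 by (simp add: tpow_Suc)
    qed
    also have "\<dots> = (\<Sum>p\<in>triples d (Suc k). \<phi> (tmon i p @ w))" by (rule S)
    finally show ?thesis .
  next
    case 2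
    have "(\<Sum>p\<in>triples d k. \<phi> (YT j # tmon i p @ w))
        = (\<Sum>(a, b, c)\<in>triples d k. \<phi> (tmon i (a, Suc b mod d, c) @ w))"
    proof (rule sum.cong[OF refl], clarify)
      fix a b c assume "(a, b, c) \<in> triples d k"
      then show "\<phi> (YT j # tmon i (a, b, c) @ w) = \<phi> (tmon i (a, Suc b mod d, c) @ w)"
        using tmon_mod[OF Y assms(2), of a "Suc b" c w] lt 2 assms(2)
          perm[of "YT j # tmon i (a, b, c)" "tmon i (a, Suc b, c)"] by simp
    qed
    also have "\<dots> = (\<Sum>(a, b, c)\<in>triples d k. \<phi> (tmon i (b, Suc a mod d, c) @ w))"
      by (subst triples_swap(1)[symmetric]) simp
    also have "\<dots> = (\<Sum>(a, b, c)\<in>triples d (Suc k). \<phi> (tmon i (b, a, c) @ w))"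
      using S[of "\<lambda>(a, b, c). \<phi> (tmon i (b, a, c) @ w)" k] by simp
    also have "\<dots> = (\<Sum>p\<in>triples d (Suc k). \<phi> (tmon i p @ w))"
      by (rule triples_swap(1))
    finally show ?thesis .
  next
    case 3
    have "(\<Sum>p\<in>triples d k. \<phi> (YT j # tmon i p @ w))
        = (\<Sum>(a, b, c)\<in>triples d k. \<phi> (tmon i (a, b, Suc c mod d) @ w))"
    proof (rule sum.cong[OF refl], clarify)
      fix a b c assume "(a, b, c) \<in> triples d k"
      then show "\<phi> (YT j # tmon i (a, b, c) @ w) = \<phi> (tmon i (a, b, Suc c mod d) @ w)"
        using tmon_mod[OF Y assms(2), of a b "Suc c" w] lt 3 assms(2)
          perm[of "YT j # tmon i (a, b, c)" "tmon i (a, b, Suc c)"] by simp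
    qed
    also have "\<dots> = (\<Sum>(a, b, c)\<in>triples d k. \<phi> (tmon i (a, c, Suc b mod d) @ w))"
      by (subst triples_swap(2)[symmetric]) simp
    also have "\<dots> = (\<Sum>(a, b, c)\<in>triples d k. \<phi> (tmon i (b, c, Suc a mod d) @ w))"
      by (subst triples_swap(1)[symmetric]) simp
    also have "\<dots> = (\<Sum>(a, b, c)\<in>triples d (Suc k). \<phi> (tmon i (b, c, a) @ w))"
      using S[of "\<lambda>(a, b, c). \<phi> (tmon i (b, c, a) @ w)" k] by simp
    also have "\<dots> = (\<Sum>(a, b, c)\<in>triples d (Suc k). \<phi> (tmon i (a, c, b) @ w))"
      by (subst triples_swap(1)[symmetric]) simp
    also have "\<dots> = (\<Sum>p\<in>triples d (Suc k). \<phi> (tmon i p @ w))"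
      by (rule triples_swap(2))
    finally show ?thesis .
  qed
qed

text \<open>Passing \<open>g_j\<close> transposes two exponents, and the set of triples is invariant
  under this.\<close>

lemma g_tmon:
  assumes Y: "Yfun d u \<phi>" and "1 \<le> i" and j: "j = i \<or> j = Suc i"
  shows "(\<Sum>p\<in>triples d k. \<phi> (YG j # tmon i p @ w)) = (\<Sum>p\<in>triples d k. \<phi> (tmon i p @ YG j # w))"
proof -
  have g: "\<phi> (YG j # v @ w) = \<phi> (v' @ YG j # w)" if "tword v" "mset (map (swap_gen j) v) = mset v'" for v v'
  proof -
    have "tword (map (swap_gen j) v)" using that(1) assms by (fastforce simp: tword_def)
    with weqD[OF weq_tword_perm[OF this that(2), of d u] Yfun_suffix[OF Y, of "YG j # w"]]
      weqD[OF weq_g_tword[OF _ that(1), of j d u] Yfun_suffix[OF Y, of w]] assms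
    show ?thesis by auto
  qed
  from j show ?thesis
  proof
    assume ji: "j = i"
    have "(\<Sum>p\<in>triples d k. \<phi> (YG j # tmon i p @ w))
        = (\<Sum>(a, b, c)\<in>triples d k. \<phi> (tmon i (b, a, c) @ YG j # w))"
      by (intro sum.cong refl, clarify, rule g) (use ji assms(2) in auto)
    also have "\<dots> = (\<Sum>p\<in>triples d k. \<phi> (tmon i p @ YG j # w))" by (rule triples_swap(1))
    finally show ?thesis .
  next
    assume ji: "j = Suc i"
    have "(\<Sum>p\<in>triples d k. \<phi> (YG j # tmon i p @ w))
        = (\<Sum>(a, b, c)\<in>triples d k. \<phi> (tmon i (a, c, b) @ YG j # w))"
      by (intro sum.cong refl, clarify, rule g) (use ji assms(2) in auto)
    also have "\<dots> = (\<Sum>p\<in>triples d k. \<phi> (tmon i p @ YG j # w))" by (rule triples_swap(2))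
    finally show ?thesis .
  qed
qed

lemma Rsum_t:
  assumes "Yfun d u \<phi>" and "1 \<le> i" "1 \<le> d" and "i \<le> j" "j \<le> i + 2"
  shows "Rsum d i k (\<lambda>y. \<phi> (YT j # y)) = Rsum d i (Suc k) \<phi>"
  using t_tmon[OF assms] t_tmon[OF assms, where w = "[]"]
  by (simp add: Rsum_def g_sym3_def sum.distrib)

text \<open>Next to the sum, \<open>e_j\<close> acts as the identity because t_j^s t_{j+1}^{d-s} has
  degree d. The quadratic relation becomes the Hecke relation g_j^2 = u + (u - 1) g_j.\<close>

lemma tmon_gg:
  assumes Y: "Yfun d u \<phi>" and i: "1 \<le> i" "1 \<le> d" and j: "j = i \<or> j = Suc i"
  shows "(\<Sum>p\<in>triples d k. \<phi> (tmon i p @ YG j # YG j # w))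
     = u * (\<Sum>p\<in>triples d k. \<phi> (tmon i p @ w)) + (u - 1) * (\<Sum>p\<in>triples d k. \<phi> (tmon i p @ YG j # w))"
proof -
  have ee: "(\<Sum>p\<in>triples d k. \<phi> (tmon i p @ tpow j s @ tpow (Suc j) (d - s) @ w))
      = (\<Sum>p\<in>triples d k. \<phi> (tmon i p @ w))" if "s < d" for s w
  proof -
    have pw: "(\<Sum>p\<in>triples d k. \<phi> (v @ tpow l s @ tmon i p @ w))
        = (\<Sum>p\<in>triples d (k + s). \<phi> (v @ tmon i p @ w))" if "i \<le> l" "l \<le> i + 2" for k v l s
    proof (induction s arbitrary: k v)
      case (Suc s)
      have "(\<Sum>p\<in>triples d k. \<phi> ((v @ [YT l]) @ tpow l s @ tmon i p @ w))
          = (\<Sum>p\<in>triples d (k + s). \<phi> ((v @ [YT l]) @ tmon i p @ w))" by (rule Suc)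
      also have "\<dots> = (\<Sum>p\<in>triples d (Suc (k + s)). \<phi> (v @ tmon i p @ w))"
        using t_tmon[OF Yfun_prefix[OF Y, of v] i that, of w "k + s"] by simp
      finally show ?case by (simp add: tpow_Suc)
    qed simp
    have "\<phi> (tmon i p @ tpow j s @ tpow (Suc j) (d - s) @ w)
        = \<phi> (tpow j s @ tpow (Suc j) (d - s) @ tmon i p @ w)" for p
      using weqD[OF weq_tword_perm[of "tmon i p @ tpow j s @ tpow (Suc j) (d - s)"
          "tpow j s @ tpow (Suc j) (d - s) @ tmon i p" d u] Yfun_suffix[OF Y, of w]] i j
      by (cases p) auto
    then have "(\<Sum>p\<in>triples d k. \<phi> (tmon i p @ tpow j s @ tpow (Suc j) (d - s) @ w))
        = (\<Sum>p\<in>triples d (k + (d - s)). \<phi> (tpow j s @ tmon i p @ w))"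
      using pw[where l = "Suc j" and k = k and v = "tpow j s" and s = "d - s"] j by auto
    also have "\<dots> = (\<Sum>p\<in>triples d (k + (d - s) + s). \<phi> (tmon i p @ w))"
      using pw[where l = j and k = "k + (d - s)" and v = "[]" and s = s] j by auto
    also have "triples d (k + (d - s) + s) = triples d k"
      using that by (simp add: triples_def)
    finally show ?thesis .
  qed
  have "(\<Sum>p\<in>triples d k. \<phi> (tmon i p @ YG j # YG j # w)) = (\<Sum>p\<in>triples d k. \<phi> (tmon i p @ w))
     + (u - 1) * ((\<Sum>s<d. \<Sum>p\<in>triples d k. \<phi> (tmon i p @ tpow j s @ tpow (Suc j) (d - s) @ w)) / of_nat d)
     + (u - 1) * ((\<Sum>s<d. \<Sum>p\<in>triples d k. \<phi> (tmon i p @ tpow j s @ tpow (Suc j) (d - s) @ YG j # w)) / of_nat d)"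
    using j i by (subst Yfun_quadratic[OF Y])
      (auto simp: sum.distrib sum_distrib_left[symmetric] sum_divide_distrib[symmetric]
         sum.swap[of _ "triples d k" "{..<d}"])
  then show ?thesis using ee i by (simp add: algebra_simps)
qed

text \<open>With the Hecke relation of \<open>tmon_gg\<close>, pairing w with s_j w shows that the
  sum of the six g_w is an eigenvector of \<open>g_j\<close> for the eigenvalue u.\<close>

lemma Rsum_g:
  assumes Y: "Yfun d u \<phi>" and i: "1 \<le> i" "1 \<le> d" and j: "j = i \<or> j = Suc i"
  shows "Rsum d i k (\<lambda>y. \<phi> (YG j # y)) = u * Rsum d i k \<phi>"
proof -
  define \<Psi> where "\<Psi> w = (\<Sum>p\<in>triples d k. \<phi> (tmon i p @ w))" for w
  have R: "Rsum d i k \<phi> = (\<Sum>g\<leftarrow>g_sym3 i. \<Psi> g)"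
    by (simp add: Rsum_def \<Psi>_def g_sym3_def sum.distrib)
  have "Rsum d i k (\<lambda>y. \<phi> (YG j # y)) = (\<Sum>g\<leftarrow>g_sym3 i. \<Psi> (YG j # g))"
    using g_tmon[OF Y i(1) j] g_tmon[OF Y i(1) j, where w = "[]"] by (simp add: Rsum_def \<Psi>_def g_sym3_def sum.distrib)
  also have "\<dots> = u * (\<Sum>g\<leftarrow>g_sym3 i. \<Psi> g)"
  proof -
    have q: "\<Psi> (YG j # YG j # w) = u * \<Psi> w + (u - 1) * \<Psi> (YG j # w)" for w
      unfolding \<Psi>_def by (rule tmon_gg[OF assms])
    have YP: "Yfun d u \<Psi>"
      unfolding \<Psi>_def by (intro Yfun_sum Yfun_prefix Y)
    \<comment> \<open>For j = i + 1 the braid relation converts between the two reduced words of the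
      longest element.\<close>
    have b0: "\<Psi> [YG (Suc i), YG i, YG (Suc i)] = \<Psi> [YG i, YG (Suc i), YG i]"
      using weqD[OF weq_braid[OF i(1), of d u] YP] .
    have b1: "\<Psi> [YG (Suc i), YG i, YG (Suc i), YG i] = \<Psi> [YG (Suc i), YG (Suc i), YG i, YG (Suc i)]"
      using weqD[OF weq_braid[OF i(1), of d u] Yfun_prefix[OF YP, of "[YG (Suc i)]"]] by simp
    from j show ?thesis
    proof
      assume "j = i"
      with q show ?thesis by (simp add: g_sym3_def algebra_simps)
    next
      assume ji: "j = Suc i"
      note q' = q[unfolded ji]
      show ?thesis unfolding ji by (simp add: g_sym3_def b0 b1 q' algebra_simps)
    qed
  qed
  finally show ?thesis by (simp add: R)
qed

section \<open>Conjugation raising all indices by one\<close>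

fun shift_gen :: "ygen \<Rightarrow> ygen" where
  "shift_gen (YG j) = YG (Suc j)"
| "shift_gen (YT j) = YT (Suc j)"

text \<open>For c = g_i g_{i+1} g_{i+2} the braid relations give c g_i = g_{i+1} c and c g_{i+1} =
  g_{i+2} c; on the \<open>t_j\<close> involved, the three transpositions compose to j -> j +
  1.\<close>

lemma weq_shift:
  assumes "1 \<le> i" and "\<forall>l\<in>set w. l \<in> {YG i, YG (Suc i), YT i, YT (Suc i), YT (Suc (Suc i))}"
  shows "weq d u ([YG i, YG (Suc i), YG (Suc (Suc i))] @ w)
           (map shift_gen w @ [YG i, YG (Suc i), YG (Suc (Suc i))])"
proof -
  let ?C = "[YG i, YG (Suc i), YG (Suc (Suc i))]"
  have letter: "weq d u (?C @ [l]) (shift_gen l # ?C)"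
    if "l \<in> {YG i, YG (Suc i), YT i, YT (Suc i), YT (Suc (Suc i))}" for l
    using that
  proof (elim insertE emptyE)
    assume l: "l = YG i"
    have "weq d u [YG i, YG (Suc i), YG (Suc (Suc i)), YG i] [YG i, YG (Suc i), YG i, YG (Suc (Suc i))]"
      using weq_context[OF weq_gg[of "Suc (Suc i)" i d u], of "[YG i, YG (Suc i)]" "[]"] assms by simp
    also have "weq d u \<dots> [YG (Suc i), YG i, YG (Suc i), YG (Suc (Suc i))]"
      using weq_context[OF weq_sym[OF weq_braid[of i d u]], of "[]" "[YG (Suc (Suc i))]"] assms by simp
    finally show ?thesis using l by simp
  next
    assume l: "l = YG (Suc i)"
    have "weq d u [YG i, YG (Suc i), YG (Suc (Suc i)), YG (Suc i)]
        [YG i, YG (Suc (Suc i)), YG (Suc i), YG (Suc (Suc i))]"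
      using weq_context[OF weq_sym[OF weq_braid[of "Suc i" d u]], of "[YG i]" "[]"] by simp
    also have "weq d u \<dots> [YG (Suc (Suc i)), YG i, YG (Suc i), YG (Suc (Suc i))]"
      using weq_context[OF weq_gg[of i "Suc (Suc i)" d u], of "[]" "[YG (Suc i), YG (Suc (Suc i))]"]
        assms by simp
    finally show ?thesis using l by simp
  next
    have t: "weq d u (?C @ [YT j]) (swap_gen i (swap_gen (Suc i) (swap_gen (Suc (Suc i)) (YT j))) # ?C)"
      if "1 \<le> j" for j
    proof -
      have *: "weq d u (v @ [YG k] @ [l] @ w) (v @ [swap_gen k l] @ [YG k] @ w)"
        if "\<exists>j\<ge>1. l = YT j" "1 \<le> k" for v w k l
        using weq_context[OF weq_gt[of k _ d u], of _ v w] that by fastforce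
      have pos: "\<exists>j\<ge>1. swap_gen k l = YT j" if "\<exists>j\<ge>1. l = YT j" "1 \<le> k" for k l
        using that by fastforce
      have j: "\<exists>j'\<ge>1. YT j = YT j'" using that by simp
      note p2 = pos[OF j, of "Suc (Suc i)"]
      note p1 = pos[OF p2, of "Suc i"]
      have "weq d u (?C @ [YT j])
          ([YG i, YG (Suc i), swap_gen (Suc (Suc i)) (YT j), YG (Suc (Suc i))])"
        using *[OF j, of "Suc (Suc i)" "[YG i, YG (Suc i)]" "[]"] by simp
      also have "weq d u \<dots> ([YG i, swap_gen (Suc i) (swap_gen (Suc (Suc i)) (YT j)),
          YG (Suc i), YG (Suc (Suc i))])"
        using *[OF p2, of "Suc i" "[YG i]" "[YG (Suc (Suc i))]"] by simp
      also have "weq d u \<dots> ([swap_gen i (swap_gen (Suc i) (swap_gen (Suc (Suc i)) (YT j))),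
          YG i, YG (Suc i), YG (Suc (Suc i))])"
        using *[OF p1, of i "[]" "[YG (Suc i), YG (Suc (Suc i))]"] assms by simp
      finally show ?thesis .
    qed
    {
      assume l: "l = YT i"
      with t[of i] assms show ?thesis by simp
    next
      assume l: "l = YT (Suc i)"
      with t[of "Suc i"] assms show ?thesis by simp
    next
      assume l: "l = YT (Suc (Suc i))"
      with t[of "Suc (Suc i)"] assms show ?thesis by simp
    }
  qed
  show ?thesis
    using assms(2)
  proof (induction w)
    case (Cons l w)
    have "weq d u (?C @ l # w) (shift_gen l # ?C @ w)"
      using weq_context[OF letter[of l], of "[]" w] Cons.prems by simp
    also have "weq d u \<dots> (shift_gen l # map shift_gen w @ ?C)"
      using Cons by (intro weq_Cons) simp
    finally show ?case by simp
  qed simp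
qed

lemma shift_tmon: "map shift_gen (tmon i p) = tmon (Suc i) p"
  by (cases p) (simp add: tpow_def)

text \<open>Conjugation by \<open>g\<^sub>i g\<^bsub>i+1\<^esub> g\<^bsub>i+2\<^esub>\<close> maps \<open>r\<^bsub>i,i+1\<^esub>\<close> to \<open>r\<^bsub>i+1,i+2\<^esub>\<close>.\<close>
lemma Rsum_shift:
  assumes "Yfun d u \<phi>" and "1 \<le> i"
  shows "Rsum d i k (\<lambda>y. \<phi> ([YG i, YG (Suc i), YG (Suc (Suc i))] @ y))
       = Rsum d (Suc i) k (\<lambda>y. \<phi> (y @ [YG i, YG (Suc i), YG (Suc (Suc i))]))"
proof -
  let ?C = "[YG i, YG (Suc i), YG (Suc (Suc i))]"
  have g: "g_sym3 (Suc i) = map (map shift_gen) (g_sym3 i)" by (simp add: g_sym3_def)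
  have "\<phi> (?C @ tmon i p @ w) = \<phi> ((tmon (Suc i) p @ map shift_gen w) @ ?C)" if "w \<in> set (g_sym3 i)" for p w
  proof -
    have "\<forall>l\<in>set (tmon i p @ w). l \<in> {YG i, YG (Suc i), YT i, YT (Suc i), YT (Suc (Suc i))}"
      using that by (cases p) (auto simp: g_sym3_def tpow_def)
    from weqD[OF weq_shift[OF assms(2) this] assms(1)] show ?thesis
      by (simp add: shift_tmon)
  qed
  then show ?thesis
    unfolding Rsum_def g map_map comp_def
    by (intro sum.cong refl arg_cong[of _ _ sum_list] map_cong) auto
qed

subsection \<open>Markov traces\<close>

text \<open>Here the relations and cyclicity hold for arbitrary words, which spares index
  bounds.\<close>

locale markov_functional =
  fixes d :: nat and u z :: complex and x :: "nat \<Rightarrow> complex" and tr :: "yword \<Rightarrow> complex"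
  assumes d_pos: "1 \<le> d"
    and Yfun_tr: "Yfun d u tr"
    and tr_Nil: "tr [] = 1"
    and tr_cyc: "tr (v @ w) = tr (w @ v)"
    and tr_g: "1 \<le> n \<Longrightarrow> in_Y n a \<Longrightarrow> tr (a @ [YG n]) = z * tr a"
    and tr_t: "in_Y n a \<Longrightarrow> 1 \<le> s \<Longrightarrow> s \<le> d - 1 \<Longrightarrow> tr (a @ tpow (Suc n) s) = x s * tr a"
begin

text \<open>The periodic extension lets exponents of t be added without reducing them.\<close>

definition X :: "nat \<Rightarrow> complex" where
  "X k = xext x (k mod d)"

lemma X_mod: "X (k mod d) = X k"
  by (simp add: X_def)

lemma tr_tpow: assumes "in_Y n a" shows "tr (a @ tpow (Suc n) k) = X k * tr a"
proof -
  have "tr (a @ tpow (Suc n) k) = tr (a @ tpow (Suc n) (k mod d))"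
    using weqD[OF weq_tpow_mod[of "Suc n" d u k] Yfun_prefix[OF Yfun_tr, of a]] by simp
  also have "\<dots> = X k * tr a"
  proof (cases "k mod d = 0")
    case True
    then show ?thesis by (simp add: X_def xext_def)
  next
    case False
    moreover have "k mod d < d" using d_pos by simp
    ultimately show ?thesis using tr_t[OF assms, of "k mod d"]
      by (simp add: X_def xext_def)
  qed
  finally show ?thesis .
qed

section \<open>Traces of t-monomials times the six \<open>g_w\<close>\<close>

lemma tr_t1: "tr (tpow 1 k) = X k"
  using tr_tpow[of 0 "[]" k] by (simp add: tr_Nil)

lemma tr_t12: "tr (tpow 1 a @ tpow 2 b) = X a * X b"
  using tr_tpow[of 1 "tpow 1 a" b] tr_t1[of a] by (simp add: numeral_2_eq_2)

lemma tr_perm: "tword v \<Longrightarrow> mset v = mset w \<Longrightarrow> tr (a @ v @ b) = tr (a @ w @ b)"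
  using weqD[OF weq_tword_perm Yfun_context[OF Yfun_tr]] .

lemma tr_gt: "1 \<le> i \<Longrightarrow> tword w \<Longrightarrow> tr (a @ YG i # w @ b) = tr (a @ map (swap_gen i) w @ YG i # b)"
  using weqD[OF weq_g_tword Yfun_context[OF Yfun_tr, of a b], of i w] by simp

text \<open>t_2^b passes g_1 as t_1^b and merges with t_1^a by cyclicity; then the Markov property
  removes g_1.\<close>

lemma tr_t12_g1: "tr (tpow 1 a @ tpow 2 b @ [YG 1]) = z * X (a + b)"
proof -
  have "tr (tpow 1 a @ tpow 2 b @ [YG 1]) = tr (tpow 1 a @ YG 1 # tpow 1 b)"
    using tr_gt[of 1 "tpow 1 b" "tpow 1 a" "[]"] by (simp add: numeral_2_eq_2)
  also have "\<dots> = tr (tpow 1 b @ tpow 1 a @ [YG 1])"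
    using tr_cyc[of "tpow 1 a @ [YG 1]" "tpow 1 b"] by simp
  also have "\<dots> = z * X (a + b)"
    using tr_g[of 1 "tpow 1 (b + a)"] tr_t1[of "b + a"] 
    by (simp add: tpow_add add.commute[of a b])
  finally show ?thesis .
qed

lemma tr_tmon: "tr (tmon 1 (a, b, c)) = X a * X b * X c"
  using tr_tpow[of 2 "tpow 1 a @ tpow 2 b" c] tr_t12[of a b] by (simp add: numeral_2_eq_2)

lemma tr_tmon_g1: "tr (tmon 1 (a, b, c) @ [YG 1]) = z * X (a + b) * X c"
proof -
  have "tr (tpow 1 a @ tpow 2 b @ tpow 3 c @ [YG 1]) = tr ((tpow 1 a @ tpow 2 b @ [YG 1]) @ tpow 3 c)"
    using tr_gt[of 1 "tpow 3 c" "tpow 1 a @ tpow 2 b" "[]"] by simp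
  also have "\<dots> = X c * (z * X (a + b))"
    using tr_tpow[of 2 "tpow 1 a @ tpow 2 b @ [YG 1]" c] tr_t12_g1[of a b] by (simp add: eval_nat_numeral)
  finally show ?thesis by (simp add: eval_nat_numeral)
qed

text \<open>Common step for words with one \<open>g_2\<close>: once t_3^c has passed it as t_2^c,
  the other letters lie in \<open>Y_2\<close>, so cyclicity puts \<open>g_2\<close> last and the
  Markov property applies.\<close>

lemma t3_g2: "tr (v @ tpow 3 c @ YG 2 # w) = tr (v @ YG 2 # tpow 2 c @ w)"
  using tr_gt[of 2 "tpow 2 c" v w] by (simp add: eval_nat_numeral)

lemma tr_tmon_g2: "tr (tmon 1 (a, b, c) @ [YG 2]) = z * X a * X (b + c)"
proof -
  have "tr (tpow 1 a @ tpow 2 b @ tpow 3 c @ [YG 2]) = tr ((tpow 1 a @ tpow 2 b @ [YG 2]) @ tpow 2 c)"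
    using t3_g2[of "tpow 1 a @ tpow 2 b" c "[]"] by simp
  also have "\<dots> = tr ((tpow 2 c @ tpow 1 a @ tpow 2 b) @ [YG 2])"
    using tr_cyc[of "tpow 1 a @ tpow 2 b @ [YG 2]" "tpow 2 c"] by simp
  also have "\<dots> = z * tr (tpow 2 c @ tpow 1 a @ tpow 2 b)"
    by (rule tr_g) simp_all
  also have "tr (tpow 2 c @ tpow 1 a @ tpow 2 b) = tr (tpow 1 a @ tpow 2 (b + c))"
    using tr_perm[of "tpow 2 c @ tpow 1 a @ tpow 2 b" "tpow 1 a @ tpow 2 (b + c)" "[]" "[]"]
    by (simp add: tpow_add)
  also have "\<dots> = X a * X (b + c)" by (rule tr_t12)
  finally show ?thesis by (simp add: eval_nat_numeral)
qed

lemma tr_tmon_g1g2: "tr (tmon 1 (a, b, c) @ [YG 1, YG 2]) = z\<^sup>2 * X (a + b + c)"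
proof -
  have "tr (tpow 1 a @ tpow 2 b @ tpow 3 c @ [YG 1, YG 2])
      = tr ((tpow 1 a @ tpow 2 b @ [YG 1]) @ tpow 3 c @ [YG 2])"
    using tr_gt[of 1 "tpow 3 c" "tpow 1 a @ tpow 2 b" "[YG 2]"] by simp
  also have "\<dots> = tr ((tpow 1 a @ tpow 2 b @ [YG 1, YG 2]) @ tpow 2 c)"
    using t3_g2[of "tpow 1 a @ tpow 2 b @ [YG 1]" c "[]"] by simp
  also have "\<dots> = tr ((tpow 2 c @ tpow 1 a @ tpow 2 b @ [YG 1]) @ [YG 2])"
    using tr_cyc[of "tpow 1 a @ tpow 2 b @ [YG 1, YG 2]" "tpow 2 c"] by simp
  also have "\<dots> = z * tr (tpow 2 c @ tpow 1 a @ tpow 2 b @ [YG 1])"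
    by (rule tr_g) simp_all
  also have "tr (tpow 2 c @ tpow 1 a @ tpow 2 b @ [YG 1]) = tr (tpow 1 a @ tpow 2 (b + c) @ [YG 1])"
    using tr_perm[of "tpow 2 c @ tpow 1 a @ tpow 2 b" "tpow 1 a @ tpow 2 (b + c)" "[]" "[YG 1]"]
    by (simp add: tpow_add)
  also have "\<dots> = z * X (a + (b + c))" by (rule tr_t12_g1)
  finally show ?thesis by (simp add: eval_nat_numeral add.assoc)
qed

lemma tr_tmon_g2g1: "tr (tmon 1 (a, b, c) @ [YG 2, YG 1]) = z\<^sup>2 * X (a + b + c)"
proof -
  have "tr (tpow 1 a @ tpow 2 b @ tpow 3 c @ [YG 2, YG 1])
      = tr ((tpow 1 a @ tpow 2 b @ [YG 2]) @ (tpow 2 c @ [YG 1]))"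
    using t3_g2[of "tpow 1 a @ tpow 2 b" c "[YG 1]"] by simp
  also have "\<dots> = tr ((tpow 2 c @ [YG 1] @ tpow 1 a @ tpow 2 b) @ [YG 2])"
    using tr_cyc[of "tpow 1 a @ tpow 2 b @ [YG 2]" "tpow 2 c @ [YG 1]"] by simp
  also have "\<dots> = z * tr (tpow 2 c @ [YG 1] @ tpow 1 a @ tpow 2 b)"
    by (rule tr_g) simp_all
  also have "tr (tpow 2 c @ [YG 1] @ tpow 1 a @ tpow 2 b) = tr (tpow 1 a @ tpow 2 b @ tpow 2 c @ [YG 1])"
    using tr_cyc[of "tpow 2 c @ [YG 1]" "tpow 1 a @ tpow 2 b"] by simp
  also have "\<dots> = z * X (a + (b + c))" using tr_t12_g1[of a "b + c"] by (simp add: tpow_add)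
  finally show ?thesis by (simp add: eval_nat_numeral add.assoc)
qed

lemma tr_t12_g1g1:
  "tr (tpow 1 a @ tpow 2 b @ [YG 1, YG 1])
   = X a * X b + (u - 1) * ((\<Sum>s<d. X (a + s) * X (b + (d - s))) / of_nat d) + (u - 1) * z * X (a + b)"
proof -
  have e: "tr (tpow 1 a @ tpow 2 b @ tpow 1 s @ tpow 2 r @ w) = tr (tpow 1 (a + s) @ tpow 2 (b + r) @ w)" for s r w
    using tr_perm[of "tpow 1 a @ tpow 2 b @ tpow 1 s @ tpow 2 r" "tpow 1 (a + s) @ tpow 2 (b + r)" "[]" w]
    by (simp add: tpow_add)
  have 1: "tr (tpow 1 a @ tpow 2 b @ tpow 1 s @ tpow 2 r) = X (a + s) * X (b + r)" for s r
    using e[of s r "[]"] tr_t12[of "a + s" "b + r"] by simp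
  have 2: "tr (tpow 1 a @ tpow 2 b @ tpow 1 s @ tpow 2 (d - s) @ [YG 1]) = z * X (a + b)" if "s < d" for s
  proof -
    \<comment> \<open>Only the sum of the exponents matters, so all d terms agree and the factor 1/d
      in \<open>e_1\<close> cancels.\<close>
    have "X (a + s + (b + (d - s))) = X (a + b)"
      using that by (simp add: X_def add.assoc[symmetric])
    then show ?thesis using e[of s "d - s" "[YG 1]"] tr_t12_g1[of "a + s" "b + (d - s)"] by simp
  qed
  have S: "Suc 1 = 2" by simp
  have "tr ((tpow 1 a @ tpow 2 b) @ YG 1 # YG 1 # []) = X a * X b
     + (u - 1) * ((\<Sum>s<d. X (a + s) * X (b + (d - s))) / of_nat d)
     + (u - 1) * ((\<Sum>s<d. z * X (a + b)) / of_nat d)"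
    unfolding Yfun_quadratic[OF Yfun_tr order_refl, of "tpow 1 a @ tpow 2 b" "[]"]
    unfolding S append_Nil2 append.assoc using 1 2 tr_t12 by simp
  then show ?thesis using d_pos by simp
qed

text \<open>Removing \<open>g_2\<close> leaves t_2^c between two letters \<open>g_1\<close>; moved
  to the left it becomes t_1^c, which pairs a with c. The remaining \<open>g_1 g_1\<close> produces
  the convolution sum.\<close>

lemma tr_tmon_g1g2g1: "tr (tmon 1 (a, b, c) @ [YG 1, YG 2, YG 1])
   = z * (X (a + c) * X b + (u - 1) * ((\<Sum>s<d. X (a + c + s) * X (b + (d - s))) / of_nat d)
      + (u - 1) * z * X (a + b + c))"
proof -
  have "tr (tpow 1 a @ tpow 2 b @ tpow 3 c @ [YG 1, YG 2, YG 1])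
      = tr ((tpow 1 a @ tpow 2 b @ [YG 1]) @ tpow 3 c @ [YG 2, YG 1])"
    using tr_gt[of 1 "tpow 3 c" "tpow 1 a @ tpow 2 b" "[YG 2, YG 1]"] by simp
  also have "\<dots> = tr (tpow 1 a @ tpow 2 b @ YG 1 # YG 2 # tpow 2 c @ [YG 1])"
    using t3_g2[of "tpow 1 a @ tpow 2 b @ [YG 1]" c "[YG 1]"] by simp
  also have "\<dots> = tr ((tpow 2 c @ [YG 1] @ tpow 1 a @ tpow 2 b @ [YG 1]) @ [YG 2])"
    using tr_cyc[of "tpow 1 a @ tpow 2 b @ [YG 1, YG 2]" "tpow 2 c @ [YG 1]"] by simp
  also have "\<dots> = z * tr (tpow 2 c @ [YG 1] @ tpow 1 a @ tpow 2 b @ [YG 1])"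
    by (rule tr_g) simp_all
  also have "tr (tpow 2 c @ [YG 1] @ tpow 1 a @ tpow 2 b @ [YG 1])
      = tr (tpow 1 a @ tpow 2 b @ YG 1 # tpow 2 c @ [YG 1])"
    using tr_cyc[of "tpow 2 c @ [YG 1]" "tpow 1 a @ tpow 2 b @ [YG 1]"] by simp
  also have "\<dots> = tr (tpow 1 a @ tpow 2 b @ tpow 1 c @ [YG 1, YG 1])"
    using tr_gt[of 1 "tpow 2 c" "tpow 1 a @ tpow 2 b" "[YG 1]"] by simp
  also have "\<dots> = tr (tpow 1 (a + c) @ tpow 2 b @ [YG 1, YG 1])"
    using tr_perm[of "tpow 1 a @ tpow 2 b @ tpow 1 c" "tpow 1 (a + c) @ tpow 2 b" "[]" "[YG 1, YG 1]"]
    by (simp add: tpow_add)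
  finally show ?thesis unfolding tr_t12_g1g1 by (simp add: eval_nat_numeral ac_simps)
qed

text \<open>The trace of t_1^a t_2^b t_3^c g_{1,2}: 2 z^2 collects the two words of length two, and
  the final factor z belongs to the longest word.\<close>

definition trace_term :: "nat \<Rightarrow> nat \<Rightarrow> nat \<Rightarrow> complex" where
  "trace_term a b c = X a * X b * X c + z * X (a + b) * X c + z * X a * X (b + c) + 2 * z\<^sup>2 * X (a + b + c)
     + z * (X (a + c) * X b + (u - 1) * ((\<Sum>s<d. X (a + c + s) * X (b + (d - s))) / of_nat d)
      + (u - 1) * z * X (a + b + c))"

lemma Rsum_tr: "Rsum d 1 k tr = (\<Sum>(a, b, c)\<in>triples d k. trace_term a b c)"
proof -
  have "(\<Sum>g\<leftarrow>g_sym3 1. tr (tmon 1 (a, b, c) @ g)) = trace_term a b c" for a b c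
  proof -
    have S: "Suc 1 = 2" by simp
    show ?thesis
      unfolding g_sym3_def S trace_term_def
      using tr_tmon[of a b c] tr_tmon_g1[of a b c] tr_tmon_g2[of a b c] tr_tmon_g1g2[of a b c]
        tr_tmon_g2g1[of a b c] tr_tmon_g1g2g1[of a b c]
      by (simp del: tmon.simps)
  qed
  then show ?thesis unfolding Rsum_def by (intro sum.cong) auto
qed

section \<open>Reduction of the whole ideal to d equations\<close>

lemma Rsum_tr_Y3:
  assumes "\<And>k. Rsum d 1 k tr = 0" and "in_Y 3 m"
  shows "Rsum d 1 k (\<lambda>y. tr (m @ y)) = 0"
  using assms(2)
proof (induction m arbitrary: k rule: rev_induct)
  case Nil
  then show ?case using assms(1) by simp
next
  case (snoc l m)
  have Y: "Yfun d u (\<lambda>y. tr (m @ y))" by (rule Yfun_prefix[OF Yfun_tr])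
  have IH: "Rsum d 1 k (\<lambda>y. tr (m @ y)) = 0" for k using snoc by simp
  show ?case
  \<comment> \<open>The last letter of the prefix acts first: \<open>g_j\<close> gives the factor u,
    and \<open>t_j\<close> raises k by one, so k must vary in the induction.\<close>
  proof (cases l)
    case (YG j)
    with snoc.prems have "j = 1 \<or> j = Suc 1" by auto
    from Rsum_g[OF Y order_refl d_pos this, of k] IH YG show ?thesis by simp
  next
    case (YT j)
    with snoc.prems have "1 \<le> j" "j \<le> 1 + 2" by auto
    from Rsum_t[OF Y order_refl d_pos this, of k] IH YT show ?thesis by simp
  qed
qed

text \<open>Makes the spanning argument and \<open>g_cancel\<close> applicable to the
  prefix.\<close>

lemma Yfun_Rsum: "Yfun d u (\<lambda>m. Rsum d i k (\<lambda>y. tr (m @ y)))"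
  unfolding Rsum_def g_sym3_def by (simp, intro Yfun_sum Yfun_add Yfun_suffix Yfun_tr)

lemma Rsum_smult: "Rsum d i k (\<lambda>y. c * \<phi> y) = c * Rsum d i k \<phi>"
  by (simp add: Rsum_def g_sym3_def sum_distrib_left distrib_left)

lemma Rsum_cong:
  assumes "1 \<le> i" "\<And>y. in_Y (i + 2) y \<Longrightarrow> \<phi> y = \<psi> y"
  shows "Rsum d i k \<phi> = Rsum d i k \<psi>"
proof -
  have "in_Y (i + 2) (tmon i p @ w)" if "w \<in> set (g_sym3 i)" for p w
    using that assms(1) by (cases p) (auto simp: g_sym3_def)
  then show ?thesis
    unfolding Rsum_def using assms(2)
    by (intro sum.cong refl arg_cong[of _ _ sum_list] map_cong) auto
qed

text \<open>Only prefixes a g_n b and a t_{n+1}^j b need a check. As r_{1,2} lies in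
  \<open>Y_n\<close>, cyclicity moves the new letter to the end, and the Markov property leaves the
  prefix a b.\<close>

lemma Rsum_tr_Yn:
  assumes "\<And>k. Rsum d 1 k tr = 0" and "3 \<le> n" and "in_Y n m"
  shows "Rsum d 1 k (\<lambda>y. tr (m @ y)) = 0"
  using assms(2,3)
proof (induction n arbitrary: m rule: dec_induct)
  case base
  then show ?case using Rsum_tr_Y3 assms(1) by blast
next
  case (step n)
  have "kills_span n (\<lambda>m. Rsum d 1 k (\<lambda>y. tr (m @ y)))"
    unfolding kills_span_def
  proof (intro allI impI conjI)
    fix a b assume ab: "in_Y n a" "in_Y n b"
    have Yn: "in_Y n y" if "in_Y (1 + 2) y" for y
      using in_Y_mono[OF that] step.hyps by simp
    show "Rsum d 1 k (\<lambda>y. tr ((a @ [YG n] @ b) @ y)) = 0"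
    proof -
      have "Rsum d 1 k (\<lambda>y. tr ((a @ [YG n] @ b) @ y)) = Rsum d 1 k (\<lambda>y. z * tr ((a @ b) @ y))"
      proof (rule Rsum_cong)
        fix y assume "in_Y (1 + 2) y"
        then have y: "in_Y n y" by (rule Yn)
        have "tr ((a @ [YG n] @ b) @ y) = tr ((b @ y @ a) @ [YG n])"
          using tr_cyc[of "a @ [YG n]" "b @ y"] by simp
        also have "\<dots> = z * tr (b @ y @ a)"
          using step.hyps ab y by (intro tr_g) auto
        finally show "tr ((a @ [YG n] @ b) @ y) = z * tr ((a @ b) @ y)"
          using tr_cyc[of a "b @ y"] by simp
      qed simp
      then show ?thesis using step.IH[of "a @ b"] ab by (simp add: Rsum_smult)
    qed
    show "Rsum d 1 k (\<lambda>y. tr ((a @ tpow (Suc n) j @ b) @ y)) = 0" for j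
    proof -
      have "Rsum d 1 k (\<lambda>y. tr ((a @ tpow (Suc n) j @ b) @ y)) = Rsum d 1 k (\<lambda>y. X j * tr ((a @ b) @ y))"
      proof (rule Rsum_cong)
        fix y assume "in_Y (1 + 2) y"
        then have y: "in_Y n y" by (rule Yn)
        have "tr ((a @ tpow (Suc n) j @ b) @ y) = tr ((b @ y @ a) @ tpow (Suc n) j)"
          using tr_cyc[of "a @ tpow (Suc n) j" "b @ y"] by simp
        also have "\<dots> = X j * tr (b @ y @ a)"
          using ab y by (intro tr_tpow) auto
        finally show "tr ((a @ tpow (Suc n) j @ b) @ y) = X j * tr ((a @ b) @ y)"
          using tr_cyc[of a "b @ y"] by simp
      qed simp
      then show ?thesis using step.IH[of "a @ b"] ab by (simp add: Rsum_smult)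
    qed
  qed
  from kills_span_imp_zero[OF Yfun_Rsum this step.prems] show ?case .
qed

lemma Rsum_tr_all:
  assumes "u \<noteq> 0" "\<And>k. Rsum d 1 k tr = 0" "1 \<le> i" "i + 2 \<le> n" "in_Y n m"
  shows "Rsum d i k (\<lambda>y. tr (m @ y)) = 0"
  using assms(3,4,5)
proof (induction i arbitrary: m rule: dec_induct)
  case base
  then show ?case by (intro Rsum_tr_Yn[OF assms(2)]) auto
next
  case (step i)
  define \<psi> where "\<psi> m = Rsum d (Suc i) k (\<lambda>y. tr (m @ y))" for m
  have Y: "Yfun d u \<psi>" unfolding \<psi>_def by (rule Yfun_Rsum)
  \<comment> \<open>Cyclicity carries the conjugating word to the right end, where
    \<open>Rsum_shift\<close> trades index i + 1 for i.\<close>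
  have C: "\<psi> ([YG i, YG (Suc i), YG (Suc (Suc i))] @ m) = 0" if "in_Y n m" for m
  proof -
    let ?C = "[YG i, YG (Suc i), YG (Suc (Suc i))]"
    have "\<psi> (?C @ m) = Rsum d (Suc i) k (\<lambda>y. tr (m @ y @ ?C))"
      unfolding \<psi>_def using tr_cyc[of ?C "m @ _"] by simp
    also have "\<dots> = Rsum d i k (\<lambda>y. tr (m @ ?C @ y))"
      using Rsum_shift[OF Yfun_prefix[OF Yfun_tr, of m], of i k] step.hyps by simp
    also have "\<dots> = 0"
      using step.IH[of "m @ ?C"] step.hyps step.prems that by simp
    finally show ?thesis .
  qed
  have Y1: "Yfun d u (\<lambda>m. \<psi> ([YG i] @ m))" and Y2: "Yfun d u (\<lambda>m. \<psi> ([YG i, YG (Suc i)] @ m))"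
    using Y by (blast intro: Yfun_prefix)+
  have n: "1 \<le> Suc (Suc i)" "Suc (Suc i) < n" "1 \<le> Suc i" "Suc i < n" "1 \<le> i" "i < n"
    using step by auto
  \<comment> \<open>The three letters are cancelled from right to left; all their indices are below
    n.\<close>
  have "\<psi> ([YG i, YG (Suc i)] @ m) = 0" if "in_Y n m" for m
    using g_cancel[OF Y2 assms(1) d_pos n(1,2) _ that] C by simp
  then have "\<psi> ([YG i] @ m) = 0" if "in_Y n m" for m
    using g_cancel[OF Y1 assms(1) d_pos n(3,4) _ that] by simp
  then have "\<psi> m = 0" if "in_Y n m" for m
    using g_cancel[OF Y assms(1) d_pos n(5,6) _ that] by simp
  then show ?case using step.prems by (simp add: \<psi>_def)
qed

lemma passes_FTL_iff:
  assumes "u \<noteq> 0" "3 \<le> n"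
  shows "passes_FTL d n tr \<longleftrightarrow> (\<forall>k<d. (\<Sum>(a, b, c)\<in>triples d k. trace_term a b c) = 0)"
proof
  assume P: "passes_FTL d n tr"
  have "Rsum d 1 k tr = 0" for k
  proof -
    \<comment> \<open>The prefix t_1^k turns degree 0 into degree k, so t_1^k r_{1,2} yields the
      k-th equation.\<close>
    have shift: "Rsum d 1 j (\<lambda>y. tr (v @ tpow 1 k @ y)) = Rsum d 1 (j + k) (\<lambda>y. tr (v @ y))" for j v
    proof (induction k arbitrary: j v)
      case (Suc k)
      show ?case
        using Suc[of j "v @ [YT 1]"] Rsum_t[OF Yfun_prefix[OF Yfun_tr, of v] order_refl d_pos, of 1 "j + k"]
        by (simp add: tpow_Suc)
    qed simp
    have "lc_eval tr (lc_mult (lc_mult (lc_word (tpow 1 k)) (r_lc d 1)) (lc_word [])) = 0"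
      using P assms(2) unfolding passes_FTL_def by (auto elim!: allE[of _ 1] allE[of _ "tpow 1 k"])
    then show ?thesis
      using shift[of 0 "[]"] by (simp add: lc_eval_sandwich lc_eval_r_lc[OF d_pos])
  qed
  then show "\<forall>k<d. (\<Sum>(a, b, c)\<in>triples d k. trace_term a b c) = 0"
    unfolding Rsum_tr[symmetric] by blast
next
  assume *: "\<forall>k<d. (\<Sum>(a, b, c)\<in>triples d k. trace_term a b c) = 0"
  have R: "Rsum d 1 k tr = 0" for k
    using *[rule_format, of "k mod d"] d_pos Rsum_mod[of d 1 k] by (simp add: Rsum_tr[symmetric])
  show "passes_FTL d n tr"
    unfolding passes_FTL_def lc_eval_sandwich lc_eval_r_lc[OF d_pos]
  proof (intro allI impI)
    fix i v w assume i: "1 \<le> i" "i \<le> n - 2" and vw: "in_Y n v" "in_Y n w"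
    have "Rsum d i 0 (\<lambda>y. tr (v @ y @ w)) = Rsum d i 0 (\<lambda>y. tr ((w @ v) @ y))"
      using tr_cyc[of "v @ _" w] by simp
    also have "\<dots> = 0"
      by (rule Rsum_tr_all[OF assms(1) R, of _ n]) (use i vw assms(2) in auto)
    finally show "Rsum d i 0 (\<lambda>y. tr (v @ y @ w)) = 0" .
  qed
qed

end

subsection \<open>Fourier analysis\<close>

definition unity_root :: "nat \<Rightarrow> nat \<Rightarrow> complex" where
  "unity_root d m = cis (2 * pi * real m / real d)"

lemma unity_root_pow_d: "1 \<le> d \<Longrightarrow> unity_root d m ^ d = 1"
  by (simp add: unity_root_def DeMoivre)

lemma unity_root_nonzero [simp]: "unity_root d m \<noteq> 0"
  by (simp add: unity_root_def)

lemma unity_root_pow_commute: "unity_root d m ^ k = unity_root d k ^ m"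
  by (simp add: unity_root_def DeMoivre mult_ac)

lemma exp_eq_unity_root:
  "exp (2 * pi * \<i> * of_nat (k * m) / of_nat d) = unity_root d m ^ k"
  unfolding unity_root_def DeMoivre unfolding cis_conv_exp by (rule arg_cong[of _ _ exp]) (simp add: mult_ac)

lemma exp_uminus_eq_unity_root:
  "exp (- 2 * pi * \<i> * of_nat (k * m) / of_nat d) = inverse (unity_root d m) ^ k"
proof -
  have "exp (- 2 * pi * \<i> * of_nat (k * m) / of_nat d)
      = inverse (exp (2 * pi * \<i> * of_nat (k * m) / of_nat d))"
    unfolding exp_minus[symmetric] by simp
  then show ?thesis unfolding exp_eq_unity_root by (simp add: power_inverse)
qed

text \<open>For distinct indices the ratio is a d-th root of unity other than 1, and its geometric
  sum vanishes.\<close>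

lemma unity_root_orthogonal:
  assumes "j < d" "k < d"
  shows "(\<Sum>m<d. unity_root d j ^ m * inverse (unity_root d k) ^ m) = (if j = k then of_nat d else 0)"
proof (cases "j = k")
  case True
  then show ?thesis by (simp add: power_mult_distrib[symmetric])
next
  case False
  let ?\<omega> = "unity_root d j * inverse (unity_root d k)"
  have "inj_on (unity_root d) {..<d}"
    using bij_betw_roots_unity[of d] assms unfolding unity_root_def bij_betw_def by auto
  then have "unity_root d j \<noteq> unity_root d k"
    using False assms by (auto dest: inj_onD)
  then have "?\<omega> \<noteq> 1" by (simp add: field_simps)
  moreover have "?\<omega> ^ d = 1"
    using unity_root_pow_d assms by (simp add: power_mult_distrib power_inverse)
  ultimately have "(\<Sum>m<d. ?\<omega> ^ m) = 0" by (simp add: geometric_sum)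
  then show ?thesis using False by (simp add: power_mult_distrib)
qed

lemma dft_inverse:
  assumes "k < d"
  shows "(\<Sum>m<d. (\<Sum>j<d. f j * inverse (unity_root d m) ^ j) * unity_root d m ^ k) = of_nat d * f k"
proof -
  have "(\<Sum>m<d. (\<Sum>j<d. f j * inverse (unity_root d m) ^ j) * unity_root d m ^ k)
      = (\<Sum>m<d. \<Sum>j<d. f j * (unity_root d k ^ m * inverse (unity_root d j) ^ m))"
    unfolding sum_distrib_right power_inverse
    by (intro sum.cong refl) (simp add: unity_root_pow_commute[of d k] unity_root_pow_commute[of d _ "_ :: nat"] mult_ac)
  also have "\<dots> = (\<Sum>j<d. f j * (if k = j then of_nat d else 0))"
    by (subst sum.swap) (simp add: sum_distrib_left[symmetric] unity_root_orthogonal assms)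
  also have "\<dots> = of_nat d * f k" using assms by (simp add: if_distrib cong: if_cong)
  finally show ?thesis .
qed

text \<open>Inversion in the other order, used to read off the transform of a given combination of
  characters.\<close>

lemma dft_of_inverse:
  assumes "m < d"
  shows "(\<Sum>k<d. (\<Sum>j<d. g j * unity_root d j ^ k) * inverse (unity_root d m) ^ k) = of_nat d * g m"
proof -
  have "(\<Sum>k<d. (\<Sum>j<d. g j * unity_root d j ^ k) * inverse (unity_root d m) ^ k)
      = (\<Sum>k<d. \<Sum>j<d. g j * (unity_root d j ^ k * inverse (unity_root d m) ^ k))"
    unfolding sum_distrib_right by (simp add: mult_ac)
  also have "\<dots> = (\<Sum>j<d. g j * (if j = m then of_nat d else 0))"
    by (subst sum.swap) (simp add: sum_distrib_left[symmetric] unity_root_orthogonal assms)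
  also have "\<dots> = of_nat d * g m" using assms by (simp add: if_distrib cong: if_cong)
  finally show ?thesis .
qed

lemma sum_periodic_shift:
  fixes h :: "nat \<Rightarrow> complex"
  assumes "1 \<le> d" and per: "\<And>k. h (k mod d) = h k"
  shows "(\<Sum>a<d. h (a + c)) = (\<Sum>a<d. h a)"
proof (induction c)
  case (Suc c)
  have "(\<Sum>a<d. h (a + Suc c)) = (\<Sum>a<d. h (Suc a + c))" by simp
  also have "\<dots> = (\<Sum>a<Suc d. h (a + c)) - h c"
    by (subst sum.lessThan_Suc_shift) simp
  also have "\<dots> = (\<Sum>a<d. h (a + c))"
    using per[of "d + c"] per[of c] by simp
  finally show ?case using Suc by simp
qed simp

section \<open>Fourier transform of the trace equations\<close>

context markov_functional
begin

text \<open>Summing over k removes the degree constraint, and zeta^k splits over the exponents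
  because zeta^d = 1. Over the full cube each independent factor sums to y and each idle variable
  contributes d.\<close>

lemma dft_trace_term:
  assumes \<zeta>: "\<zeta> ^ d = 1"
  defines "y \<equiv> (\<Sum>k<d. X k * \<zeta> ^ k)"
  shows "(\<Sum>k<d. (\<Sum>(a, b, c)\<in>triples d k. trace_term a b c) * \<zeta> ^ k)
       = y * (y + of_nat d * z) * (y + of_nat d * z * (u + 1))"
proof -
  define Z where "Z k = X k * \<zeta> ^ k" for k
  have pm: "\<zeta> ^ (k mod d) = \<zeta> ^ k" for k
  proof -
    have "\<zeta> ^ k = \<zeta> ^ (d * (k div d) + k mod d)" by simp
    also have "\<dots> = \<zeta> ^ (k mod d)" unfolding power_add power_mult \<zeta> by simp
    finally show ?thesis by simp
  qed
  have per: "Z (k mod d) = Z k" for k by (simp add: Z_def X_mod pm)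
  have yZ: "(\<Sum>a<d. Z a) = y" by (simp add: y_def Z_def)
  have sh: "(\<Sum>a<d. Z (a + c)) = y" "(\<Sum>a<d. Z (c + a)) = y" for c
    using sum_periodic_shift[where h = Z, OF d_pos per, of c] yZ by (simp_all add: add.commute)
  let ?D = "of_nat d :: complex"
  let ?B = "{..<d} \<times> {..<d} \<times> {..<d}"
  have "(\<Sum>k<d. (\<Sum>(a, b, c)\<in>triples d k. trace_term a b c) * \<zeta> ^ k)
      = (\<Sum>k<d. \<Sum>p\<in>{p \<in> ?B. (case p of (a, b, c) \<Rightarrow> (a + b + c) mod d) = k}.
           (case p of (a, b, c) \<Rightarrow> trace_term a b c * \<zeta> ^ (a + b + c)))"
    unfolding sum_distrib_right
  proof (rule sum.cong[OF refl], rule sum.cong)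
    fix k assume "k \<in> {..<d}"
    then show "triples d k = {p \<in> ?B. (case p of (a, b, c) \<Rightarrow> (a + b + c) mod d) = k}"
      by (auto simp: triples_def)
    fix p assume p: "p \<in> {p \<in> ?B. (case p of (a, b, c) \<Rightarrow> (a + b + c) mod d) = k}"
    obtain a b c where [simp]: "p = (a, b, c)" by (cases p) auto
    from p have "\<zeta> ^ k = \<zeta> ^ (a + b + c)" using pm[of "a + b + c"] by auto
    then show "(case p of (a, b, c) \<Rightarrow> trace_term a b c) * \<zeta> ^ k
        = (case p of (a, b, c) \<Rightarrow> trace_term a b c * \<zeta> ^ (a + b + c))" by simp
  qed
  also have "\<dots> = (\<Sum>p\<in>?B. (case p of (a, b, c) \<Rightarrow> trace_term a b c * \<zeta> ^ (a + b + c)))"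
    by (rule sum.group) (use d_pos in auto)
  also have "\<dots> = (\<Sum>a<d. \<Sum>b<d. \<Sum>c<d. trace_term a b c * \<zeta> ^ (a + b + c))"
    by (simp add: sum.cartesian_product)
  \<comment> \<open>(u + 1) z^2 is 2 z^2 from the words of length two plus (u - 1) z^2 from the
    longest word.\<close>
  also have "\<dots> = (\<Sum>a<d. \<Sum>b<d. \<Sum>c<d. Z a * Z b * Z c + z * (Z (a + b) * Z c) + z * (Z a * Z (b + c))
      + z * (Z (a + c) * Z b) + (u + 1) * z\<^sup>2 * Z (a + b + c)
      + z * (u - 1) / ?D * (\<Sum>s<d. Z (a + c + s) * Z (b + (d - s))))"
  proof (intro sum.cong refl)
    fix a b c
    have e: "(\<Sum>s<d. Z (a + c + s) * Z (b + (d - s)))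
        = (\<Sum>s<d. X (a + c + s) * X (b + (d - s))) * \<zeta> ^ (a + b + c)"
      unfolding sum_distrib_right
    proof (rule sum.cong[OF refl])
      fix s assume "s \<in> {..<d}"
      then have "a + c + s + (b + (d - s)) = a + b + c + d" by simp
      then have "\<zeta> ^ (a + c + s) * \<zeta> ^ (b + (d - s)) = \<zeta> ^ (a + b + c)"
        unfolding power_add[symmetric] by (simp add: power_add \<zeta>)
      then show "Z (a + c + s) * Z (b + (d - s)) = X (a + c + s) * X (b + (d - s)) * \<zeta> ^ (a + b + c)"
        by (simp add: Z_def)
    qed
    show "trace_term a b c * \<zeta> ^ (a + b + c)
        = Z a * Z b * Z c + z * (Z (a + b) * Z c) + z * (Z a * Z (b + c))
        + z * (Z (a + c) * Z b) + (u + 1) * z\<^sup>2 * Z (a + b + c)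
        + z * (u - 1) / ?D * (\<Sum>s<d. Z (a + c + s) * Z (b + (d - s)))"
      unfolding e
      unfolding trace_term_def Z_def using d_pos
      by (simp add: field_simps power_add power2_eq_square)
  qed
  also have "\<dots> = y ^ 3 + z * (?D * y\<^sup>2) + z * (?D * y\<^sup>2) + z * (?D * y\<^sup>2) + (u + 1) * z\<^sup>2 * (?D\<^sup>2 * y)
      + z * (u - 1) / ?D * (?D\<^sup>2 * y\<^sup>2)"
  proof -
    have 1: "(\<Sum>a<d. \<Sum>b<d. \<Sum>c<d. Z a * Z b * Z c) = y ^ 3"
      by (simp add: sum_distrib_left[symmetric] sum_distrib_right[symmetric] yZ power3_eq_cube)
    have 2: "(\<Sum>a<d. \<Sum>b<d. \<Sum>c<d. Z (a + b) * Z c) = ?D * y\<^sup>2"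
      by (simp add: sum_distrib_left[symmetric] sum_distrib_right[symmetric] yZ sh power2_eq_square)
    have 3: "(\<Sum>a<d. \<Sum>b<d. \<Sum>c<d. Z a * Z (b + c)) = ?D * y\<^sup>2"
      by (simp add: sum_distrib_left[symmetric] sum_distrib_right[symmetric] yZ sh power2_eq_square)
    have 4: "(\<Sum>a<d. \<Sum>b<d. \<Sum>c<d. Z (a + c) * Z b) = ?D * y\<^sup>2"
      by (simp add: sum_distrib_left[symmetric] sum_distrib_right[symmetric] yZ sh power2_eq_square)
    have 5: "(\<Sum>a<d. \<Sum>b<d. \<Sum>c<d. Z (a + b + c)) = ?D\<^sup>2 * y"
      by (simp add: sh power2_eq_square)
    \<comment> \<open>With s outermost, c runs over a period of the first factor, b over one of the
      second, and a is idle.\<close>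
    define f where "f a b c s = Z (a + c + s) * Z (b + (d - s))" for a b c s
    have "(\<Sum>a<d. \<Sum>b<d. \<Sum>c<d. \<Sum>s<d. f a b c s) = (\<Sum>a<d. \<Sum>b<d. \<Sum>s<d. \<Sum>c<d. f a b c s)"
      by (rule sum.cong[OF refl], rule sum.cong[OF refl], rule sum.swap)
    also have "\<dots> = (\<Sum>a<d. \<Sum>s<d. \<Sum>b<d. \<Sum>c<d. f a b c s)"
      by (rule sum.cong[OF refl], rule sum.swap)
    also have "\<dots> = (\<Sum>s<d. \<Sum>a<d. \<Sum>b<d. \<Sum>c<d. f a b c s)"
      by (rule sum.swap)
    also have "\<dots> = (\<Sum>s<d. ?D * y\<^sup>2)"
    proof (rule sum.cong[OF refl])
      fix s
      have "(\<Sum>c<d. Z (a + c + s)) = y" for a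
        using sh(2)[of "a + s"] by (simp add: ac_simps)
      then show "(\<Sum>a<d. \<Sum>b<d. \<Sum>c<d. f a b c s) = ?D * y\<^sup>2"
        by (simp add: f_def sum_distrib_left[symmetric] sum_distrib_right[symmetric] sh(1) power2_eq_square)
    qed
    finally have 6: "(\<Sum>a<d. \<Sum>b<d. \<Sum>c<d. \<Sum>s<d. Z (a + c + s) * Z (b + (d - s))) = ?D\<^sup>2 * y\<^sup>2"
      by (simp add: f_def power2_eq_square)
    have pull: "(\<Sum>a<d. \<Sum>b<d. \<Sum>c<d. r * h a b c) = r * (\<Sum>a<d. \<Sum>b<d. \<Sum>c<d. h a b c)"
      for r :: complex and h
      by (simp only: sum_distrib_left)
    show ?thesis
      by (simp only: sum.distrib pull 1 2 3 4 5 6)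
  qed
  also have "\<dots> = y * (y + ?D * z) * (y + ?D * z * (u + 1))"
    using d_pos by (simp add: field_simps power2_eq_square power3_eq_cube)
  finally show ?thesis .
qed

lemma fourier_hat_eq: "fourier_hat d x m = (\<Sum>k<d. X k * inverse (unity_root d m) ^ k)"
  unfolding fourier_hat_def exp_uminus_eq_unity_root
  by (intro sum.cong refl) (simp add: X_def)

text \<open>Each frequency gives the cubic of \<open>dft_trace_term\<close> with these three roots,
  and Fourier inversion shows that the d frequencies together are equivalent to the d
  equations.\<close>

lemma passes_FTL_iff_fourier:
  assumes "u \<noteq> 0" "3 \<le> n"
  shows "passes_FTL d n tr \<longleftrightarrow> (\<forall>m<d. fourier_hat d x m \<in> {0, - of_nat d * z, - of_nat d * z * (u + 1)})"
proof -
  define F where "F k = (\<Sum>(a, b, c)\<in>triples d k. trace_term a b c)" for k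
  have hat: "(\<Sum>k<d. F k * inverse (unity_root d m) ^ k) = fourier_hat d x m
     * (fourier_hat d x m + of_nat d * z) * (fourier_hat d x m + of_nat d * z * (u + 1))" for m
    unfolding F_def fourier_hat_eq
    by (rule dft_trace_term) (simp add: power_inverse unity_root_pow_d[OF d_pos])
  have "(\<forall>k<d. F k = 0) \<longleftrightarrow> (\<forall>m<d. (\<Sum>k<d. F k * inverse (unity_root d m) ^ k) = 0)"
    using dft_inverse[of _ d F] by auto
  also have "\<dots> \<longleftrightarrow> (\<forall>m<d. fourier_hat d x m \<in> {0, - of_nat d * z, - of_nat d * z * (u + 1)})"
    unfolding hat by (simp add: add_eq_0_iff2)
  finally show ?thesis
    using passes_FTL_iff[OF assms] by (simp add: F_def)
qed

end

text \<open>The words of a relation have positive indices only, so an index 0 comes from the context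
  and kills all terms at once; otherwise all values are those of \<open>tr\<close>.\<close>

lemma markov_functional_of_trace:
  assumes "1 \<le> d" and M: "is_markov_trace d u z x tr"
  defines "tr' \<equiv> \<lambda>w. if \<exists>n. in_Y n w then tr w else 0"
  shows "markov_functional d u z x tr'"
proof
  have tr': "tr' w = tr w" if "in_Y n w" for n w using that by (auto simp: tr'_def)
  have ex: "(\<exists>n. in_Y n (v @ w)) \<longleftrightarrow> (\<exists>n. in_Y n v) \<and> (\<exists>n. in_Y n w)" for v w
    by (metis in_Y_mono in_Y_simps(2) nat_le_linear)
  show "1 \<le> d" by fact
  show "Yfun d u tr'"
    unfolding Yfun_def
  proof (intro ballI allI)
    fix r v w assume r: "r \<in> Y_rels d u"
    have pos: "\<exists>n. in_Y n y" if "y \<in> snd ` set r" for y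
    proof -
      have "\<forall>g\<in>set y. case g of YG i \<Rightarrow> 1 \<le> i | YT i \<Rightarrow> 1 \<le> i"
        using r that unfolding Y_rels_def
        by (auto simp: tpow_def e_lc_def lc_smult_def lc_mult_word_right)
      then show ?thesis
      proof (induction y)
        case (Cons g y)
        then obtain n where "in_Y n y" by auto
        then have "in_Y (n + Suc (case g of YG i \<Rightarrow> i | YT i \<Rightarrow> i)) (g # y)"
          using Cons.prems in_Y_mono[of n y] by (cases g) auto
        then show ?case by blast
      qed auto
    qed
    show "lc_eval (\<lambda>y. tr' (v @ y @ w)) r = 0"
    proof (cases "(\<exists>n. in_Y n v) \<and> (\<exists>n. in_Y n w)")
      case True
      then obtain n where n: "in_Y n v" "in_Y n w" by (metis in_Y_mono nat_le_linear)
      have "lc_eval (\<lambda>y. tr' (v @ y @ w)) r = lc_eval (\<lambda>y. tr (v @ y @ w)) r"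
      proof -
        have "tr' (v @ y @ w) = tr (v @ y @ w)" if "y \<in> snd ` set r" for y
        proof -
          have "\<exists>n. in_Y n (v @ y @ w)" unfolding ex using pos[OF that] True by blast
          then show ?thesis by (simp only: tr'_def if_True)
        qed
        then show ?thesis unfolding lc_eval_def
          by (intro arg_cong[of _ _ sum_list] map_cong) (auto simp: image_iff, metis snd_conv)
      qed
      also have "\<dots> = 0"
        using M r n by (auto simp: is_markov_trace_def vanishes_on_Y_ideal_def lc_eval_sandwich)
      finally show ?thesis .
    next
      case False
      then have "tr' (v @ y @ w) = 0" for y by (auto simp: tr'_def ex)
      then show ?thesis by (simp add: lc_eval_def case_prod_unfold)
    qed
  qed
  show "tr' [] = 1"
    using M tr'[of 0 "[]"] by (simp add: is_markov_trace_def)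
  show "tr' (v @ w) = tr' (w @ v)" for v w
  proof (cases "(\<exists>n. in_Y n v) \<and> (\<exists>n. in_Y n w)")
    case True
    then obtain n where n: "in_Y n v" "in_Y n w" by (metis in_Y_mono nat_le_linear)
    then show ?thesis
      using M tr'[of n "v @ w"] tr'[of n "w @ v"] unfolding is_markov_trace_def by auto
  next
    case False
    then show ?thesis by (auto simp: tr'_def ex)
  qed
  show "tr' (a @ [YG n]) = z * tr' a" if "1 \<le> n" "in_Y n a" for n a
    using M that tr'[of n a] tr'[of "Suc n" "a @ [YG n]"] in_Y_mono[of n a "Suc n"]
    by (simp add: is_markov_trace_def)
  show "tr' (a @ tpow (Suc n) s) = x s * tr' a" if "in_Y n a" "1 \<le> s" "s \<le> d - 1" for n a s
    using M that tr'[of n a] tr'[of "Suc n" "a @ tpow (Suc n) s"] in_Y_mono[of n a "Suc n"]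
    unfolding is_markov_trace_def by simp
qed

text \<open>All words tested lie in \<open>Y_n\<close> because i + 2 <= n; this exchanges a trace
  for its truncation.\<close>

lemma passes_FTL_cong:
  assumes "1 \<le> d" "\<And>w. in_Y n w \<Longrightarrow> tr w = tr' w"
  shows "passes_FTL d n tr \<longleftrightarrow> passes_FTL d n tr'"
proof -
  have "Rsum d i 0 (\<lambda>y. tr (v @ y @ w)) = Rsum d i 0 (\<lambda>y. tr' (v @ y @ w))"
    if "1 \<le> i" "i \<le> n - 2" "in_Y n v" "in_Y n w" for i v w
  proof -
    have "in_Y n (tmon i p @ g)" if "g \<in> set (g_sym3 i)" for p g
      using that \<open>1 \<le> i\<close> \<open>i \<le> n - 2\<close> by (cases p) (auto simp: g_sym3_def)
    then show ?thesis
      unfolding Rsum_def using assms(2) that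
      by (intro sum.cong refl arg_cong[of _ _ sum_list] map_cong) auto
  qed
  then show ?thesis
    unfolding passes_FTL_def lc_eval_sandwich lc_eval_r_lc[OF assms(1)] by (simp cong: imp_cong)
qed

theorem theorem5:
  fixes d n :: nat and u z :: complex and x :: "nat \<Rightarrow> complex" and tr :: "yword \<Rightarrow> complex"
  assumes "1 \<le> d" and "3 \<le> n" and "u \<noteq> 0"
    and "is_markov_trace d u z x tr"
  shows "passes_FTL d n tr \<longleftrightarrow>
    (\<exists>S1 S2. S1 \<inter> S2 = {} \<and> S1 \<union> S2 = fourier_support d x
       \<and> (\<forall>k<d. xext x k = - z * ((\<Sum>m\<in>S1. exp (2 * pi * \<i> * of_nat (k * m) / of_nat d))
                + (u + 1) * (\<Sum>m\<in>S2. exp (2 * pi * \<i> * of_nat (k * m) / of_nat d))))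
       \<and> z = - 1 / (of_nat (card S1) + (u + 1) * of_nat (card S2)))"
proof -
  define tr' where "tr' = (\<lambda>w. if \<exists>n. in_Y n w then tr w else 0)"
  interpret markov_functional d u z x tr'
    unfolding tr'_def by (rule markov_functional_of_trace[OF assms(1,4)])
  define y where "y m = fourier_hat d x m" for m
  have P: "passes_FTL d n tr \<longleftrightarrow> (\<forall>m<d. y m \<in> {0, - of_nat d * z, - of_nat d * z * (u + 1)})"
  proof -
    have "passes_FTL d n tr \<longleftrightarrow> passes_FTL d n tr'"
      by (rule passes_FTL_cong[OF assms(1)]) (auto simp: tr'_def)
    then show ?thesis using passes_FTL_iff_fourier[OF assms(3,2)] by (simp add: y_def)
  qed
  have supp: "fourier_support d x = {m. m < d \<and> y m \<noteq> 0}" by (simp add: fourier_support_def y_def)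
  show ?thesis
    unfolding exp_eq_unity_root
  proof
    assume "passes_FTL d n tr"
    with P have ym: "y m = 0 \<or> y m = - of_nat d * z \<or> y m = - of_nat d * z * (u + 1)" if "m < d" for m
      using that by auto
    \<comment> \<open>Requiring \<open>y m\<close> to be nonzero discards roots that degenerate to 0
      (z = 0 or u = -1); \<open>S2\<close> is defined by exclusion, so disjointness is
      immediate.\<close>
    define S1 where "S1 = {m. m < d \<and> y m \<noteq> 0 \<and> y m = - of_nat d * z}"
    define S2 where "S2 = {m. m < d \<and> y m \<noteq> 0 \<and> y m \<noteq> - of_nat d * z}"
    have fin: "finite S1" "finite S2" by (auto simp: S1_def S2_def)
    have disj: "S1 \<inter> S2 = {}" and un: "S1 \<union> S2 = fourier_support d x"
      by (auto simp: S1_def S2_def supp)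
    have xk: "xext x k = - z * ((\<Sum>m\<in>S1. unity_root d m ^ k) + (u + 1) * (\<Sum>m\<in>S2. unity_root d m ^ k))"
      if k: "k < d" for k
    proof -
      have "of_nat d * xext x k = (\<Sum>m<d. y m * unity_root d m ^ k)"
        using dft_inverse[OF k, of X] k unfolding y_def fourier_hat_eq by (simp add: X_def)
      also have "\<dots> = (\<Sum>m\<in>S1 \<union> S2. y m * unity_root d m ^ k)"
        by (rule sum.mono_neutral_right) (auto simp: S1_def S2_def)
      also have "\<dots> = (\<Sum>m\<in>S1. y m * unity_root d m ^ k) + (\<Sum>m\<in>S2. y m * unity_root d m ^ k)"
        by (rule sum.union_disjoint[OF fin disj])
      also have "(\<Sum>m\<in>S1. y m * unity_root d m ^ k) = (\<Sum>m\<in>S1. (- of_nat d * z) * unity_root d m ^ k)"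
        by (rule sum.cong) (auto simp: S1_def)
      also have "(\<Sum>m\<in>S2. y m * unity_root d m ^ k)
          = (\<Sum>m\<in>S2. (- of_nat d * z * (u + 1)) * unity_root d m ^ k)"
      proof (rule sum.cong[OF refl])
        fix m assume "m \<in> S2"
        then have "y m = - of_nat d * z * (u + 1)" using ym[of m] by (auto simp: S2_def)
        then show "y m * unity_root d m ^ k = - of_nat d * z * (u + 1) * unity_root d m ^ k" by simp
      qed
      also have "(\<Sum>m\<in>S1. (- of_nat d * z) * unity_root d m ^ k)
          + (\<Sum>m\<in>S2. (- of_nat d * z * (u + 1)) * unity_root d m ^ k)
          = of_nat d * (- z * ((\<Sum>m\<in>S1. unity_root d m ^ k) + (u + 1) * (\<Sum>m\<in>S2. unity_root d m ^ k)))"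
        unfolding sum_distrib_left[symmetric] by (simp add: algebra_simps)
      finally show ?thesis
        using assms(1) by (simp only: mult_left_cancel of_nat_eq_0_iff)
    qed
    \<comment> \<open>Evaluation at k = 0, where all powers of the roots are 1.\<close>
    have "1 = - z * (of_nat (card S1) + (u + 1) * of_nat (card S2))"
      using xk[of 0] assms(1) by (simp add: xext_def)
    \<comment> \<open>The equation forces q to be nonzero, so the division is genuine.\<close>
    moreover have "z = - 1 / q" if "1 = - z * q" for q
    proof -
      from that have "q \<noteq> 0" "z * q = - 1" by (auto simp: minus_equation_iff)
      then show ?thesis by (metis nonzero_eq_divide_eq)
    qed
    ultimately have "z = - 1 / (of_nat (card S1) + (u + 1) * of_nat (card S2))" by blast
    with disj un xk show "\<exists>S1 S2. S1 \<inter> S2 = {} \<and> S1 \<union> S2 = fourier_support d x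
       \<and> (\<forall>k<d. xext x k = - z * ((\<Sum>m\<in>S1. unity_root d m ^ k) + (u + 1) * (\<Sum>m\<in>S2. unity_root d m ^ k)))
       \<and> z = - 1 / (of_nat (card S1) + (u + 1) * of_nat (card S2))" by blast
  next
    assume "\<exists>S1 S2. S1 \<inter> S2 = {} \<and> S1 \<union> S2 = fourier_support d x
       \<and> (\<forall>k<d. xext x k = - z * ((\<Sum>m\<in>S1. unity_root d m ^ k) + (u + 1) * (\<Sum>m\<in>S2. unity_root d m ^ k)))
       \<and> z = - 1 / (of_nat (card S1) + (u + 1) * of_nat (card S2))"
    then obtain S1 S2 where S: "S1 \<inter> S2 = {}" "S1 \<union> S2 = fourier_support d x"
      and xk: "\<And>k. k < d \<Longrightarrow> xext x k
        = - z * ((\<Sum>m\<in>S1. unity_root d m ^ k) + (u + 1) * (\<Sum>m\<in>S2. unity_root d m ^ k))" by blast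
    have sub: "S1 \<subseteq> {..<d}" "S2 \<subseteq> {..<d}" using S(2) by (auto simp: supp)
    \<comment> \<open>The coefficients of the assumed expansion of x; inversion gives
      \<open>y m\<close> = d \<open>g m\<close>, and disjointness lets at most one indicator be
      1.\<close>
    define g where "g m = - z * ((if m \<in> S1 then 1 else 0) + (u + 1) * (if m \<in> S2 then 1 else 0))" for m
    have X: "X k = (\<Sum>m<d. g m * unity_root d m ^ k)" if "k < d" for k
    proof -
      have ind: "(\<Sum>m\<in>T. unity_root d m ^ k) = (\<Sum>m<d. (if m \<in> T then 1 else 0) * unity_root d m ^ k)"
        if "T \<subseteq> {..<d}" for T
        using that by (intro sum.mono_neutral_cong_left) auto
      show ?thesis
        using that xk[OF that] unfolding X_def g_def ind[OF sub(1)] ind[OF sub(2)]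
        by (simp add: sum_distrib_left sum.distrib[symmetric] algebra_simps)
    qed
    have "y m = of_nat d * g m" if "m < d" for m
      using dft_of_inverse[OF that, of g] X unfolding y_def fourier_hat_eq by simp
    then show "passes_FTL d n tr"
      unfolding P using S(1) by (auto simp: g_def)
  qed
qed

end
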